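(* Let $G$ be a honeycomb, 4.8.8 or 4.6.12 lattice on a torus, large enough that every non-contractible cycle has length greater than $8$, and let $e=\{v_1,v_2\}$ be any edge of $G$. Choose the shrink face $S$ among the two faces containing $e$ as one of minimal weight (number of boundary edges). Let $G'$ be the output of the defective-edge procedure applied to $(G,e,S)$, and let $K$ be the weight of $S$. Then $R(G')=(K-2)/2$. Concretely, $R(G')$ takes the following values: - honeycomb lattice: $2$; - 4.8.8 lattice: $1$ if $e$ borders a square, and $3$ if $e$ borders two octagons; - 4.6.12 lattice: $1$ if $e$ borders a square, and $2$ otherwise. Moreover, $R(G')\le R(H)$ for every lattice $H$ satisfying all of the following: - $H$ is a tri-valent, 3-face-colourable multigraph on the same torus; - $H$ has the same vertex set as $G$; - every edge of $H$ joins two vertices that are adjacent in $G$ via an edge other than $e$. Equivalently, for the heavy honeycomb, heavy 4.8.8 and heavy 4.6.12 lattices (each edge subdivided by an auxiliary vertex), this procedure removes a defective auxiliary vertex while removing the minimal number of additional auxiliary vertices.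
   Context: A colour-code lattice is a finite multigraph, in which parallel edges are allowed but loops are not, cellularly embedded in a closed surface. It must be tri-valent and 3-face-colourable. Every edge borders two faces of different colours and is assigned the third colour. The defective-edge procedure takes as input $(G,e,S)$, where $e$ is an edge of colour $D$ and $S$ is a face containing $e$, of colour $A$. Let $B$ be the third colour. 1. The merge faces are the faces of colour $B$ that share an edge with $S$. 2. For each colour-$B$ edge $f$ of $S$, add a parallel edge $f'$ of colour $D$ and a new face $\{f,f'\}$ of colour $A$. 3. Delete $S$. 4. Add a new face of colour $B$ consisting of all new edges $f'$, together with all merge-face edges not on $S$. 5. Delete the merge faces. 6. Delete the edges lying on no face; these are the colour-$D$ edges of $S$. The honeycomb, 4.8.8 and 4.6.12 lattices are the periodic (torus) versions of the uniform planar tilings by regular polygons with vertex configurations 6.6.6, 4.8.8 and 4.6.12, respectively. For a multigraph $H$ on $V(G)$, define $R(H)$ as the number of unordered pairs $\{x,y\}\neq\{v_1,v_2\}$ that are adjacent in $G$ but not adjacent in $H$. This is the number of removed connections in addition to the defective one. *)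

theory Defs
  imports Main
begin

section \<open>Combinatorial maps (cellular embeddings in orientable surfaces)\<close>

text \<open>A cellularly embedded multigraph on an orientable closed surface is represented by a
combinatorial map: a finite dart set D, a fixed-point-free involution alpha (the two darts of an
edge), a permutation sigma (cyclic rotation of darts around a vertex), and a labelling lab of darts
by vertices, constant exactly on sigma-orbits. Faces are the orbits of sigma o alpha.\<close>

definition orbit :: "('d \<Rightarrow> 'd) \<Rightarrow> 'd \<Rightarrow> 'd set" where
  "orbit f d = range (\<lambda>n. (f ^^ n) d)"

definition cmap :: "'d set \<Rightarrow> ('d \<Rightarrow> 'd) \<Rightarrow> ('d \<Rightarrow> 'd) \<Rightarrow> ('d \<Rightarrow> 'v) \<Rightarrow> bool" where
  "cmap D \<alpha> \<sigma> lab \<longleftrightarrow>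
     finite D \<and> bij_betw \<alpha> D D \<and> bij_betw \<sigma> D D \<and>
     (\<forall>d\<in>D. \<alpha> d \<noteq> d \<and> \<alpha> (\<alpha> d) = d) \<and>
     (\<forall>d\<in>D. \<forall>d'\<in>D. lab d = lab d' \<longleftrightarrow> d' \<in> orbit \<sigma> d) \<and>
     (\<forall>d\<in>D. \<forall>d'\<in>D. (d, d') \<in> ({(x, \<alpha> x) | x. x \<in> D} \<union> {(x, \<sigma> x) | x. x \<in> D})\<^sup>*)"

definition orbits :: "('d \<Rightarrow> 'd) \<Rightarrow> 'd set \<Rightarrow> 'd set set" where
  "orbits f D = orbit f ` D"

text \<open>Torus: Euler characteristic V - E + F = 0 (maps given by rotation systems are orientable).\<close>
definition torus_map :: "'d set \<Rightarrow> ('d \<Rightarrow> 'd) \<Rightarrow> ('d \<Rightarrow> 'd) \<Rightarrow> bool" where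
  "torus_map D \<alpha> \<sigma> \<longleftrightarrow>
     card (orbits \<sigma> D) + card (orbits (\<sigma> \<circ> \<alpha>) D) = card (orbits \<alpha> D)"

definition trivalent :: "'d set \<Rightarrow> ('d \<Rightarrow> 'd) \<Rightarrow> bool" where
  "trivalent D \<sigma> \<longleftrightarrow> (\<forall>d\<in>D. card (orbit \<sigma> d) = 3)"

definition loopless :: "'d set \<Rightarrow> ('d \<Rightarrow> 'd) \<Rightarrow> ('d \<Rightarrow> 'd) \<Rightarrow> bool" where
  "loopless D \<alpha> \<sigma> \<longleftrightarrow> (\<forall>d\<in>D. \<alpha> d \<notin> orbit \<sigma> d)"

text \<open>The edge of a dart, and a face viewed (as in the paper) as its set of boundary edges.\<close>
definition medge :: "('d \<Rightarrow> 'd) \<Rightarrow> 'd \<Rightarrow> 'd set" where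
  "medge \<alpha> d = {d, \<alpha> d}"

definition mface :: "('d \<Rightarrow> 'd) \<Rightarrow> ('d \<Rightarrow> 'd) \<Rightarrow> 'd \<Rightarrow> 'd set set" where
  "mface \<alpha> \<sigma> d = medge \<alpha> ` orbit (\<sigma> \<circ> \<alpha>) d"

definition map_edges :: "'d set \<Rightarrow> ('d \<Rightarrow> 'd) \<Rightarrow> 'd set set" where
  "map_edges D \<alpha> = medge \<alpha> ` D"

definition map_faces :: "'d set \<Rightarrow> ('d \<Rightarrow> 'd) \<Rightarrow> ('d \<Rightarrow> 'd) \<Rightarrow> 'd set set set" where
  "map_faces D \<alpha> \<sigma> = mface \<alpha> \<sigma> ` D"

text \<open>Weight of a face = number of its boundary edges.\<close>
definition weight :: "('d \<Rightarrow> 'd) \<Rightarrow> ('d \<Rightarrow> 'd) \<Rightarrow> 'd \<Rightarrow> nat" where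
  "weight \<alpha> \<sigma> d = card (mface \<alpha> \<sigma> d)"

section \<open>Colourings\<close>

datatype col = Ca | Cb | Cc

definition third :: "col \<Rightarrow> col \<Rightarrow> col" where
  "third a b = (THE c. c \<noteq> a \<and> c \<noteq> b)"

text \<open>Proper 3-face-colouring: every edge borders two faces of different colours.\<close>
definition proper_colouring :: "'d set \<Rightarrow> ('d \<Rightarrow> 'd) \<Rightarrow> ('d \<Rightarrow> 'd) \<Rightarrow> ('d set set \<Rightarrow> col) \<Rightarrow> bool" where
  "proper_colouring D \<alpha> \<sigma> fc \<longleftrightarrow> (\<forall>d\<in>D. fc (mface \<alpha> \<sigma> d) \<noteq> fc (mface \<alpha> \<sigma> (\<alpha> d)))"

text \<open>A lattice (in the sense of the paper) on the torus: tri-valent, loopless, cellularly embedded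
on the torus, 3-face-colourable.\<close>
definition torus_lattice :: "'d set \<Rightarrow> ('d \<Rightarrow> 'd) \<Rightarrow> ('d \<Rightarrow> 'd) \<Rightarrow> ('d \<Rightarrow> 'v) \<Rightarrow> bool" where
  "torus_lattice D \<alpha> \<sigma> lab \<longleftrightarrow>
     cmap D \<alpha> \<sigma> lab \<and> torus_map D \<alpha> \<sigma> \<and> trivalent D \<sigma> \<and> loopless D \<alpha> \<sigma> \<and>
     (\<exists>fc :: 'd set set \<Rightarrow> col. proper_colouring D \<alpha> \<sigma> fc)"

section \<open>The three lattice types (via vertex configuration)\<close>

datatype lattype = Honeycomb | L488 | L4612

definition vertex_config :: "('d \<Rightarrow> 'd) \<Rightarrow> ('d \<Rightarrow> 'd) \<Rightarrow> 'd \<Rightarrow> nat list" where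
  "vertex_config \<alpha> \<sigma> d = sort [weight \<alpha> \<sigma> d, weight \<alpha> \<sigma> (\<sigma> d), weight \<alpha> \<sigma> (\<sigma> (\<sigma> d))]"

fun config_of :: "lattype \<Rightarrow> nat list" where
  "config_of Honeycomb = [6, 6, 6]"
| "config_of L488 = [4, 8, 8]"
| "config_of L4612 = [4, 6, 12]"

definition of_type :: "lattype \<Rightarrow> 'd set \<Rightarrow> ('d \<Rightarrow> 'd) \<Rightarrow> ('d \<Rightarrow> 'd) \<Rightarrow> bool" where
  "of_type T D \<alpha> \<sigma> \<longleftrightarrow> (\<forall>d\<in>D. vertex_config \<alpha> \<sigma> d = config_of T)"

section \<open>Cycles and contractibility\<close>

text \<open>A (simple) cycle of length k = length ds: darts ds!i, consecutive, distinct vertices and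
distinct edges.\<close>
definition is_cycle :: "'d set \<Rightarrow> ('d \<Rightarrow> 'd) \<Rightarrow> ('d \<Rightarrow> 'v) \<Rightarrow> 'd list \<Rightarrow> bool" where
  "is_cycle D \<alpha> lab ds \<longleftrightarrow>
     length ds \<ge> 2 \<and> set ds \<subseteq> D \<and>
     (\<forall>i < length ds. lab (\<alpha> (ds ! i)) = lab (ds ! ((i + 1) mod length ds))) \<and>
     distinct (map lab ds) \<and> distinct (map (medge \<alpha>) ds)"

text \<open>On the torus a simple closed curve is contractible iff it separates iff it is null-homologous
over Z/2, i.e. its edge set is the mod-2 boundary of a union X of faces.\<close>
definition contractible :: "'d set \<Rightarrow> ('d \<Rightarrow> 'd) \<Rightarrow> ('d \<Rightarrow> 'd) \<Rightarrow> 'd set set \<Rightarrow> bool" where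
  "contractible D \<alpha> \<sigma> C \<longleftrightarrow>
     (\<exists>X \<subseteq> D. (\<forall>x\<in>X. \<sigma> (\<alpha> x) \<in> X) \<and>
        (\<forall>d\<in>D. (medge \<alpha> d \<in> C) \<longleftrightarrow> ((d \<in> X) \<noteq> (\<alpha> d \<in> X))))"

definition noncontr_cycles_longer :: "nat \<Rightarrow> 'd set \<Rightarrow> ('d \<Rightarrow> 'd) \<Rightarrow> ('d \<Rightarrow> 'd) \<Rightarrow> ('d \<Rightarrow> 'v) \<Rightarrow> bool" where
  "noncontr_cycles_longer n D \<alpha> \<sigma> lab \<longleftrightarrow>
     (\<forall>ds. is_cycle D \<alpha> lab ds \<and> \<not> contractible D \<alpha> \<sigma> (medge \<alpha> ` set ds) \<longrightarrow> length ds > n)"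

section \<open>The defective-edge procedure (faces as edge sets)\<close>

text \<open>Generic face-structured multigraph: edges E, endpoint map ends, faces F (sets of edges),
face colouring fc. Edge colour = the colour of neither bordering face.\<close>
definition ecol :: "'e set set \<Rightarrow> ('e set \<Rightarrow> col) \<Rightarrow> 'e \<Rightarrow> col" where
  "ecol F fc x = (THE c. \<forall>f\<in>F. x \<in> f \<longrightarrow> fc f \<noteq> c)"

text \<open>Old edges are tagged Inl, the new parallel edges f' are tagged Inr f.\<close>
definition defective_edge ::
  "'e set \<Rightarrow> ('e \<Rightarrow> 'v set) \<Rightarrow> 'e set set \<Rightarrow> ('e set \<Rightarrow> col) \<Rightarrow> 'e \<Rightarrow> 'e set \<Rightarrow>
   ('e + 'e) set \<times> (('e + 'e) \<Rightarrow> 'v set) \<times> ('e + 'e) set set \<times> (('e + 'e) set \<Rightarrow> col)" where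
  "defective_edge E ends F fc e S =
    (let A = fc S; Dc = ecol F fc e; B = third A Dc;
         merge = {M \<in> F. fc M = B \<and> M \<inter> S \<noteq> {}};
         BS = {f \<in> S. ecol F fc f = B};
         small = (\<lambda>f. {Inl f, Inr f}) ` BS;
         big = Inr ` BS \<union> Inl ` (\<Union>merge - S);
         F' = (\<lambda>M. Inl ` M) ` (F - {S} - merge) \<union> small \<union> {big};
         E1 = Inl ` E \<union> Inr ` BS;
         E' = {x \<in> E1. \<exists>M \<in> F'. x \<in> M};
         ends' = case_sum ends ends;
         fc' = (\<lambda>X. if X = big then B else if X \<in> small then A else fc (Inl -` X))
     in (E', ends', F', fc'))"

section \<open>Adjacency and the count R\<close>

definition ms_adj :: "'e set \<Rightarrow> ('e \<Rightarrow> 'v set) \<Rightarrow> 'v \<Rightarrow> 'v \<Rightarrow> bool" where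
  "ms_adj E ends x y \<longleftrightarrow> (\<exists>\<epsilon>\<in>E. ends \<epsilon> = {x, y})"

definition map_adj :: "'d set \<Rightarrow> ('d \<Rightarrow> 'd) \<Rightarrow> ('d \<Rightarrow> 'v) \<Rightarrow> 'v \<Rightarrow> 'v \<Rightarrow> bool" where
  "map_adj D \<alpha> lab x y \<longleftrightarrow> (\<exists>d\<in>D. {lab d, lab (\<alpha> d)} = {x, y})"

text \<open>R(H): number of unordered pairs other than {v1,v2} adjacent in G but not in H.\<close>
definition Rcount :: "('v \<Rightarrow> 'v \<Rightarrow> bool) \<Rightarrow> ('v \<Rightarrow> 'v \<Rightarrow> bool) \<Rightarrow> 'v \<Rightarrow> 'v \<Rightarrow> nat" where
  "Rcount adjG adjH v1 v2 =
     card ({p. \<exists>x y. p = {x, y} \<and> adjG x y \<and> \<not> adjH x y} - {{v1, v2}})"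

fun expected_R :: "lattype \<Rightarrow> bool \<Rightarrow> nat" where
  "expected_R Honeycomb _ = 2"
| "expected_R L488 sq = (if sq then 1 else 3)"
| "expected_R L4612 sq = (if sq then 1 else 2)"

text \<open>Admissible competitor H: a lattice on the torus with the same vertex set as G, each edge of
which joins two vertices adjacent in G via an edge other than e = medge alpha d0.\<close>
definition admissible_H ::
  "'d set \<Rightarrow> ('d \<Rightarrow> 'd) \<Rightarrow> ('d \<Rightarrow> 'v) \<Rightarrow> 'd \<Rightarrow> 'h set \<Rightarrow> ('h \<Rightarrow> 'h) \<Rightarrow> ('h \<Rightarrow> 'h) \<Rightarrow> ('h \<Rightarrow> 'v) \<Rightarrow> bool" where
  "admissible_H D \<alpha> lab d0 DH \<alpha>H \<sigma>H labH \<longleftrightarrow>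
     torus_lattice DH \<alpha>H \<sigma>H labH \<and> labH ` DH = lab ` D \<and>
     (\<forall>h\<in>DH. \<exists>y\<in>D. medge \<alpha> y \<noteq> medge \<alpha> d0 \<and>
        {lab y, lab (\<alpha> y)} = {labH h, labH (\<alpha>H h)})"

end

theory Submission
  imports Defs
begin

text \<open>A trivalent, properly 3-face-coloured map without faces of weight 2 has no parallel edges, and the
edges of the shrink face alternate between two colours; hence the procedure removes exactly the K/2
connections of one colour.

For the lower bound, record how often a competitor H uses each edge of G. The multiplicities at a vertex
add up to 3, and connectedness of H excludes multiplicity 3, so every vertex with an unused edge has
exactly one doubled edge. The edges of multiplicity 0 and 2 therefore form alternating cycles, which are
simple because G is bipartite. If the one through e had length 2l < K \<le> 8, it would be contractible.

Let X be a region bounded by it. All faces of X of the same colour k have the same weight W k, so W k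
divides the number of corners of colour k in X, which is the number of interior vertices plus a boundary
term read off from the left and right turns of the cycle. In addition the Euler characteristic of X is odd:
multiplying a permutation by a transposition changes the number of its cycles by one, and the product of
the face permutation of X with the involution of its interior edges has one cycle for each interior
vertex and one for the boundary. Going through the words of turns of length 4 and 6 shows that no
such X exists.\<close>

section \<open>Orbits of permutations\<close>

text \<open>Contractibility is available only as homology modulo 2: the cycle bounds a union
  \<open>X\<close> of faces, and nothing is said about the genus of \<open>X\<close>. This is why
  the region is studied through its corner counts and through its Euler characteristic modulo 2,
  which the sign of a permutation detects. The number of interior vertices remains a free unknown.
  It is the same for all three colours, so comparing their corner counts eliminates it. That
  comparison settles the 4-cycles, but some 6-cycles starting between two octagons pass it, and
  there the parity decides.

  The bound 8 enters because the lighter face at an edge has weight at most 8: a shorter alternating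
  cycle has length 2, 4 or 6, and length 2 would need parallel edges. Along that cycle the
  multiplicity and the side of the bipartition change in step, so a revisited vertex forces a
  revisited dart.\<close>

lemma orbit_self: "x \<in> orbit f x"
  unfolding orbit_def by (metis funpow_0 rangeI)

lemma orbit_step: "y \<in> orbit f x \<Longrightarrow> f y \<in> orbit f x"
proof -
  assume "y \<in> orbit f x"
  then obtain n where "y = (f ^^ n) x" unfolding orbit_def by auto
  then have "f y = (f ^^ Suc n) x" by simp
  then show ?thesis unfolding orbit_def by (rule range_eqI)
qed

lemma orbit_subset:
  assumes "x \<in> A" "\<And>y. y \<in> A \<Longrightarrow> f y \<in> A"
  shows "orbit f x \<subseteq> A"
proof -
  have "(f ^^ n) x \<in> A" for n
    using assms by (induction n) auto
  then show ?thesis unfolding orbit_def by auto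
qed

lemma orbit_mono: "y \<in> orbit f x \<Longrightarrow> orbit f y \<subseteq> orbit f x"
  using orbit_subset[of y "orbit f x" f] orbit_step[of _ f x] by blast

lemma orbit_cong_on:
  assumes "x \<in> A" "\<And>y. y \<in> A \<Longrightarrow> f y \<in> A" "\<And>y. y \<in> A \<Longrightarrow> f y = g y"
  shows "orbit f x = orbit g x"
proof -
  have "(f ^^ n) x = (g ^^ n) x \<and> (f ^^ n) x \<in> A" for n
    using assms by (induction n) auto
  then show ?thesis unfolding orbit_def by auto
qed

lemma funpow_period:
  assumes "finite D" "bij_betw f D D" "x \<in> D"
  obtains n where "n > 0" "(f ^^ n) x = x"
proof -
  have inD: "(f ^^ n) x \<in> D" for n
    using assms bij_betwE[OF assms(2)] by (induction n) auto
  have bij: "bij_betw (f ^^ n) D D" for n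
  proof (induction n)
    case (Suc n) then show ?case using bij_betw_trans[OF Suc assms(2)] by (simp add: comp_def)
  qed (simp add: bij_betw_def)
  have "\<not> inj (\<lambda>n. (f ^^ n) x)"
    using inD finite_subset[OF _ assms(1)] finite_imageD[of "\<lambda>n. (f ^^ n) x" UNIV]
    by (metis image_subsetI infinite_UNIV_nat)
  then obtain i j where "i < j" and eq: "(f ^^ i) x = (f ^^ j) x"
    unfolding inj_def by (metis linorder_neqE_nat)
  then have "(f ^^ i) x = (f ^^ i) ((f ^^ (j - i)) x)"
    by (metis add_diff_inverse_nat comp_apply funpow_add not_less_iff_gr_or_eq)
  then have "(f ^^ (j - i)) x = x"
    using bij[of i] inD assms(3) unfolding bij_betw_def inj_on_def by metis
  with \<open>i < j\<close> show thesis by (intro that[of "j - i"]) auto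
qed

lemma orbit_sym:
  assumes "finite D" "bij_betw f D D" "x \<in> D" "y \<in> orbit f x"
  shows "x \<in> orbit f y"
proof -
  obtain n where n: "n > 0" "(f ^^ n) x = x" using funpow_period[OF assms(1-3)] .
  obtain m where m: "y = (f ^^ m) x" using assms(4) unfolding orbit_def by auto
  have per: "(f ^^ (n * k)) x = x" for k
  proof (induction k)
    case (Suc k) then show ?case using n by (simp add: funpow_add)
  qed simp
  \<comment> \<open>Undo m steps by going on to the multiple \<open>n * m\<close> of the
    period.\<close>
  have "m \<le> n * m" using n by simp
  then have "(f ^^ (n * m - m)) y = (f ^^ (n * m)) x"
    unfolding m by (metis comp_apply funpow_add le_add_diff_inverse2)
  then show ?thesis using per unfolding orbit_def by (metis rangeI)
qed

lemma orbit_eq: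
  assumes "finite D" "bij_betw f D D" "x \<in> D" "y \<in> orbit f x"
  shows "orbit f y = orbit f x"
  using orbit_mono[OF assms(4)] orbit_mono[OF orbit_sym[OF assms]] by blast

lemma orbit_disjoint:
  assumes "finite D" "bij_betw f D D" "x \<in> D" "y \<in> D" "orbit f x \<noteq> orbit f y"
  shows "orbit f x \<inter> orbit f y = {}"
proof (rule ccontr)
  assume "orbit f x \<inter> orbit f y \<noteq> {}"
  then obtain z where "z \<in> orbit f x" "z \<in> orbit f y" by blast
  then show False using orbit_eq[OF assms(1,2)] assms(3-5) by metis
qed

lemma orbit_in_domain:
  assumes "bij_betw f D D" "x \<in> D"
  shows "orbit f x \<subseteq> D"
  using assms orbit_subset bij_betwE by metis

text \<open>The least period yields all four facts. They turn a cycle of a permutation into a list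
  without repetition, which is needed for the darts at a vertex and for the alternating
  cycle.\<close>

lemma orbit_period:
  assumes "finite D" "bij_betw f D D" "x \<in> D"
  shows "(f ^^ card (orbit f x)) x = x" "inj_on (\<lambda>n. (f ^^ n) x) {..<card (orbit f x)}"
    "orbit f x = (\<lambda>n. (f ^^ n) x) ` {..<card (orbit f x)}" "card (orbit f x) > 0"
proof -
  define n where "n = (LEAST n. n > 0 \<and> (f ^^ n) x = x)"
  have n: "n > 0" "(f ^^ n) x = x" and
    least: "\<And>m. m < n \<Longrightarrow> m > 0 \<Longrightarrow> (f ^^ m) x \<noteq> x"
  proof -
    have "\<exists>n. n > 0 \<and> (f ^^ n) x = x" using funpow_period[OF assms] by blast
    from LeastI_ex[OF this] show "n > 0" "(f ^^ n) x = x" unfolding n_def by auto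
    show "(f ^^ m) x \<noteq> x" if "m < n" "m > 0" for m
      using not_less_Least[of m "\<lambda>n. n > 0 \<and> (f ^^ n) x = x"] that unfolding n_def by blast
  qed
  have mod: "(f ^^ m) x = (f ^^ (m mod n)) x" for m
    using n by (simp add: funpow_mod_eq)
  have o: "orbit f x = (\<lambda>n. (f ^^ n) x) ` {..<n}"
  proof -
    have "(f ^^ m) x \<in> (\<lambda>n. (f ^^ n) x) ` {..<n}" for m
      using mod[of m] n(1) by (intro image_eqI[of _ _ "m mod n"]) auto
    then show ?thesis unfolding orbit_def by auto
  qed
  have aux: False if "i < j" "j < n" "(f ^^ i) x = (f ^^ j) x" for i j
  proof -
    \<comment> \<open>Shifting both indices by \<open>n - j\<close> turns a repetition into a return
      to x before time n.\<close>
    have "(f ^^ (n - j + i)) x = (f ^^ (n - j + j)) x"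
      using that(3) by (simp only: funpow_add comp_apply)
    then have "(f ^^ (n - j + i)) x = x" using that n by simp
    moreover have "n - j + i < n" "n - j + i > 0" using that by auto
    ultimately show False using least[of "n - j + i"] by metis
  qed
  then have inj: "inj_on (\<lambda>n. (f ^^ n) x) {..<n}"
    by (intro inj_onI) (metis lessThan_iff linorder_neqE_nat)
  have "card (orbit f x) = n" unfolding o using card_image[OF inj] by simp
  then show "(f ^^ card (orbit f x)) x = x" "inj_on (\<lambda>n. (f ^^ n) x) {..<card (orbit f x)}"
    "orbit f x = (\<lambda>n. (f ^^ n) x) ` {..<card (orbit f x)}" "card (orbit f x) > 0"
    using n inj o by auto
qed

section \<open>Transpositions and the number of cycles of a permutation\<close>

lemma orbit_swap_merge:
  assumes fin: "finite D" and bij: "bij_betw f D D" and ab: "a \<in> D" "b \<in> D" "b \<notin> orbit f a"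
    and g: "g = f(a := f b, b := f a)"
  shows "orbit g a = orbit f a \<union> orbit f b"
proof
  have "a \<noteq> b" using ab orbit_self by metis
  have a_notin: "a \<notin> orbit f b" using orbit_sym[OF fin bij] ab by blast
  show "orbit g a \<subseteq> orbit f a \<union> orbit f b"
    by (rule orbit_subset)
      (auto simp: g orbit_self orbit_step split: if_splits)
  \<comment> \<open>From a, the map g enters the cycle of b, runs through it up to b, and continues
    with \<open>f a\<close> through the cycle of a.\<close>
  have ga: "g a = f b" and gb: "g b = f a" using \<open>a \<noteq> b\<close> by (auto simp: g)
  have gf: "y \<noteq> a \<Longrightarrow> y \<noteq> b \<Longrightarrow> g y = f y" for y by (simp add: g)
  have gfb: "f b \<in> orbit g a" using orbit_step[OF orbit_self, of g a] ga by simp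
  have B: "orbit f b \<subseteq> orbit g a"
  proof -
    have "(f ^^ n) (f b) \<in> orbit g a \<and> (f ^^ n) (f b) \<in> orbit f b" for n
    proof (induction n)
      case 0 then show ?case using gfb orbit_step[OF orbit_self] by auto
    next
      case (Suc n)
      then have "(f ^^ n) (f b) \<noteq> a" using a_notin by auto
      then show ?case using Suc gfb orbit_step[of "(f ^^ n) (f b)" g a] orbit_step[of _ f b]
        by (cases "(f ^^ n) (f b) = b") (auto simp: gf)
    qed
    then have "orbit f (f b) \<subseteq> orbit g a" unfolding orbit_def[of f] by auto
    then show ?thesis using orbit_eq[OF fin bij \<open>b \<in> D\<close> orbit_step[OF orbit_self]] by simp
  qed
  have gfa: "f a \<in> orbit g a" using orbit_step[of b g a] B orbit_self gb by fastforce
  have "(f ^^ n) (f a) \<in> orbit g a \<and> (f ^^ n) (f a) \<in> orbit f a" for n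
  proof (induction n)
    case 0 then show ?case using gfa orbit_step[OF orbit_self] by auto
  next
    case (Suc n)
    then have "(f ^^ n) (f a) \<noteq> b" using ab by auto
    then show ?case using Suc gfa orbit_step[of "(f ^^ n) (f a)" g a] orbit_step[of _ f a]
      by (cases "(f ^^ n) (f a) = a") (auto simp: gf)
  qed
  then have "orbit f (f a) \<subseteq> orbit g a" unfolding orbit_def[of f] by auto
  then have "orbit f a \<subseteq> orbit g a"
    using orbit_eq[OF fin bij \<open>a \<in> D\<close> orbit_step[OF orbit_self]] by simp
  with B show "orbit f a \<union> orbit f b \<subseteq> orbit g a" by blast
qed

text \<open>The set \<open>Q\<close> is the path \<open>f b, f (f b), ..., a\<close> up to the first
  visit of a. Since g sends a back to \<open>f b\<close> and agrees with f on the rest of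
  \<open>Q\<close>, the path closes up without meeting b.\<close>

lemma orbit_swap_split:
  assumes fin: "finite D" and bij: "bij_betw f D D" and ab: "a \<in> D" "b \<in> orbit f a" "a \<noteq> b"
    and g: "g = f(a := f b, b := f a)"
  shows "b \<notin> orbit g a"
proof -
  have "a \<in> orbit f b" using orbit_sym[OF fin bij] ab by blast
  then have ex: "\<exists>m. (f ^^ m) b = a" unfolding orbit_def by auto
  define m where "m = (LEAST m. (f ^^ m) b = a)"
  have m: "(f ^^ m) b = a" unfolding m_def using LeastI_ex[OF ex] .
  have least: "j < m \<Longrightarrow> (f ^^ j) b \<noteq> a" for j unfolding m_def using not_less_Least by blast
  have "m > 0" using m ab by (cases m) auto
  define Q where "Q = (\<lambda>j. (f ^^ j) b) ` {1..m}"
  have bQ: "b \<notin> Q"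
  proof
    assume "b \<in> Q"
    then obtain j where j: "1 \<le> j" "j \<le> m" "(f ^^ j) b = b" unfolding Q_def by auto
    have "(f ^^ (m - j)) ((f ^^ j) b) = a"
      using m j(2) by (metis comp_apply funpow_add le_add_diff_inverse2)
    then show False using least[of "m - j"] j \<open>m > 0\<close> by simp
  qed
  have "orbit g a \<subseteq> Q"
  proof (rule orbit_subset)
    show "a \<in> Q" unfolding Q_def using m \<open>m > 0\<close> by (intro image_eqI[of _ _ m]) auto
  next
    fix y assume y: "y \<in> Q"
    then obtain j where j: "1 \<le> j" "j \<le> m" "y = (f ^^ j) b" unfolding Q_def by auto
    show "g y \<in> Q"
    proof (cases "j = m")
      case True
      then have "g y = (f ^^ 1) b" using j m ab by (auto simp: g)
      then show ?thesis unfolding Q_def using \<open>m > 0\<close> by (intro image_eqI[of _ _ 1]) auto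
    next
      case False
      then have "y \<noteq> a" "y \<noteq> b" using least[of j] j bQ y by auto
      then have "g y = (f ^^ Suc j) b" by (simp add: g j(3))
      then show ?thesis unfolding Q_def using j False by (intro image_eqI[of _ _ "Suc j"]) auto
    qed
  qed
  with bQ show ?thesis by blast
qed

lemma bij_betw_swap_values:
  assumes "bij_betw f D D" "a \<in> D" "b \<in> D"
  shows "bij_betw (f(a := f b, b := f a)) D D"
proof (rule bij_betw_imageI)
  have inj: "inj_on f D" and im: "f ` D = D" using assms(1) by (auto simp: bij_betw_def)
  show "inj_on (f(a := f b, b := f a)) D"
    using inj assms unfolding inj_on_def by auto
  show "(f(a := f b, b := f a)) ` D = D"
  proof
    show "(f(a := f b, b := f a)) ` D \<subseteq> D" using im assms by auto
    show "D \<subseteq> (f(a := f b, b := f a)) ` D"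
    proof
      fix y assume "y \<in> D"
      then obtain x where x: "x \<in> D" "y = f x" using im by auto
      show "y \<in> (f(a := f b, b := f a)) ` D"
        using x assms
        by (cases "x = a"; cases "x = b") (auto intro: image_eqI[of _ _ a] image_eqI[of _ _ b] image_eqI[of _ _ x])
    qed
  qed
qed

text \<open>The cycles of a and b fuse, and all others persist as \<open>rest\<close>.\<close>

lemma card_orbits_swap_merge:
  assumes fin: "finite D" and bij: "bij_betw f D D" and ab: "a \<in> D" "b \<in> D" "b \<notin> orbit f a"
  shows "card (orbits f D) = Suc (card (orbits (f(a := f b, b := f a)) D))"
proof -
  define g where "g = f(a := f b, b := f a)"
  have bg: "bij_betw g D D" unfolding g_def using bij_betw_swap_values[OF bij ab(1,2)] .
  define A B where "A = orbit f a" and "B = orbit f b"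
  define rest where "rest = orbit f ` (D - A - B)"
  note oe = orbit_eq[OF fin bij]
  have ga: "orbit g a = A \<union> B"
    unfolding A_def B_def by (rule orbit_swap_merge[OF fin bij ab g_def])
  have sub: "A \<subseteq> D" "B \<subseteq> D" unfolding A_def B_def using orbit_in_domain[OF bij] ab by auto
  have mem: "a \<in> A" "b \<in> B" by (auto simp: A_def B_def orbit_self)
  have inA: "orbit f x = A" if "x \<in> A" for x using oe[OF ab(1)] that unfolding A_def by blast
  have inB: "orbit f x = B" if "x \<in> B" for x using oe[OF ab(2)] that unfolding B_def by blast
  have dec: "D = A \<union> B \<union> (D - A - B)" using sub by blast
  have "orbit f ` A = {A}" "orbit f ` B = {B}" using inA inB mem by auto
  then have "orbits f D = insert A (insert B rest)"
    unfolding orbits_def rest_def by (subst dec) (simp add: image_Un insert_commute)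
  moreover have AB: "A \<noteq> B" using ab orbit_self unfolding A_def B_def by metis
  moreover have notin: "C \<notin> rest" if "C \<subseteq> A \<union> B" for C
  proof
    assume "C \<in> rest"
    then obtain x where "x \<in> D - A - B" "C = orbit f x" unfolding rest_def by auto
    then show False using orbit_self[of x f] that by auto
  qed
  moreover have "finite rest" unfolding rest_def using fin by simp
  ultimately have 1: "card (orbits f D) = Suc (Suc (card rest))" by simp
  have out: "orbit g x = orbit f x" if "x \<in> D - A - B" for x
  proof (rule orbit_cong_on[symmetric])
    show "x \<in> D - A - B" by (rule that)
    fix y assume y: "y \<in> D - A - B"
    show "f y = g y" using y \<open>a \<in> A\<close> \<open>b \<in> B\<close> by (auto simp: g_def)
    have "f y \<in> D" using bij_betwE[OF bij] y by blast
    moreover have "f y \<notin> orbit f z" if "z \<in> D" "y \<notin> orbit f z" for z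
    proof
      assume "f y \<in> orbit f z"
      then have "orbit f (f y) = orbit f z" by (rule oe[OF that(1)])
      moreover have "orbit f (f y) = orbit f y"
        using y by (intro oe orbit_step[OF orbit_self]) auto
      ultimately show False using that orbit_self by metis
    qed
    ultimately show "f y \<in> D - A - B" using ab y unfolding A_def B_def by blast
  qed
  have "orbit g x = A \<union> B" if "x \<in> A \<union> B" for x
    using orbit_eq[OF fin bg ab(1)] ga that by simp
  then have "orbit g ` (A \<union> B) = {A \<union> B}" using mem by auto
  moreover have "orbit g ` (D - A - B) = rest" unfolding rest_def using out by auto
  ultimately have "orbits g D = insert (A \<union> B) rest"
    unfolding orbits_def by (subst dec) (simp only: image_Un, simp)
  moreover have "A \<union> B \<notin> rest" using notin by simp
  ultimately have "card (orbits g D) = Suc (card rest)" using \<open>finite rest\<close> by simp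
  with 1 show ?thesis unfolding g_def by simp
qed

lemma card_orbits_swap_parity:
  assumes fin: "finite D" and bij: "bij_betw f D D" and ab: "a \<in> D" "b \<in> D" "a \<noteq> b"
  shows "odd (card (orbits f D) + card (orbits (f(a := f b, b := f a)) D))"
proof (cases "b \<in> orbit f a")
  case False
  then show ?thesis using card_orbits_swap_merge[OF fin bij ab(1,2)] by simp
next
  case True
  define g where "g = f(a := f b, b := f a)"
  have "b \<notin> orbit g a" using orbit_swap_split[OF fin bij ab(1) True ab(3) g_def] .
  moreover have "bij_betw g D D" unfolding g_def using bij_betw_swap_values[OF bij ab(1,2)] .
  \<comment> \<open>Exchanging the values again restores f, so a split is a merge read
    backwards.\<close>
  moreover have "g(a := g b, b := g a) = f" using ab by (auto simp: g_def)
  ultimately show ?thesis using card_orbits_swap_merge[OF fin, of g a b] ab unfolding g_def by simp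
qed

text \<open>The involution h is a product of \<open>card I / 2\<close> disjoint transpositions, each
  of which flips the parity of the number of cycles. With f the face permutation of a region and h =
  \<open>\<alpha>\<close> on its interior edges, m becomes the number of these edges.\<close>

lemma card_orbits_involution_parity:
  assumes fin: "finite D" and bij: "bij_betw f D D"
    and I: "I \<subseteq> D" "\<And>x. x \<in> I \<Longrightarrow> h x \<in> I \<and> h x \<noteq> x \<and> h (h x) = x"
  shows "\<exists>m. card I = 2 * m \<and> bij_betw (\<lambda>x. if x \<in> I then f (h x) else f x) D D \<and>
    even (card (orbits f D) + card (orbits (\<lambda>x. if x \<in> I then f (h x) else f x) D) + m)"
  using I
proof (induction "card I" arbitrary: I rule: less_induct)
  case less
  show ?case
  proof (cases "I = {}")
    case True then show ?thesis using bij by simp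
  next
    case False
    then obtain a where a: "a \<in> I" by blast
    define b where "b = h a"
    have b: "b \<in> I" "b \<noteq> a" "h b = a" using less.prems(2)[OF a] by (auto simp: b_def)
    define J where "J = I - {a, b}"
    have finI: "finite I" using less.prems(1) fin finite_subset by blast
    have cI: "card I = Suc (Suc (card J))"
    proof -
      have "I = insert a (insert b J)" "a \<notin> insert b J" "b \<notin> J" using a b by (auto simp: J_def)
      then show ?thesis using finI by (metis card_insert_disjoint finite_insert)
    qed
    have J: "h x \<in> J \<and> h x \<noteq> x \<and> h (h x) = x" if "x \<in> J" for x
    proof -
      have x: "x \<in> I" "x \<noteq> a" "x \<noteq> b" using that by (auto simp: J_def)
      have "h x \<noteq> a" "h x \<noteq> b" using less.prems(2)[OF x(1)] x b b_def by auto
      then show ?thesis using less.prems(2)[OF x(1)] by (simp add: J_def)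
    qed
    define g where "g = (\<lambda>x. if x \<in> J then f (h x) else f x)"
    obtain m where m: "card J = 2 * m" "bij_betw g D D"
      "even (card (orbits f D) + card (orbits g D) + m)"
      using less.hyps[of J] cI J less.prems(1) unfolding g_def J_def by auto
    have ab: "a \<in> D" "b \<in> D" "a \<noteq> b" using a b less.prems(1) by auto
    \<comment> \<open>As a and b are not in \<open>J\<close>, g agrees with f there, and the missing
      pair is one more exchange of values.\<close>
    have eq: "(\<lambda>x. if x \<in> I then f (h x) else f x) = g(a := g b, b := g a)"
      using a b by (auto simp: g_def J_def b_def fun_eq_iff)
    have "odd (card (orbits g D) + card (orbits (g(a := g b, b := g a)) D))"
      by (rule card_orbits_swap_parity[OF fin m(2) ab])
    then have "even (card (orbits f D) + card (orbits (g(a := g b, b := g a)) D) + Suc m)"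
      using m(3) by presburger
    moreover have "bij_betw (g(a := g b, b := g a)) D D"
      by (rule bij_betw_swap_values[OF m(2) ab(1,2)])
    ultimately show ?thesis unfolding eq using cI m(1) by (intro exI[of _ "Suc m"]) simp
  qed
qed

section \<open>Coloured trivalent maps\<close>

fun next_col :: "col \<Rightarrow> col" where
  "next_col Ca = Cb" | "next_col Cb = Cc" | "next_col Cc = Ca"

lemma third_eqI: "a \<noteq> b \<Longrightarrow> c \<noteq> a \<Longrightarrow> c \<noteq> b \<Longrightarrow> third a b = c"
  unfolding third_def by (rule the_equality) (metis col.exhaust)+

lemma col_cases3:
  fixes a b c d :: col
  assumes "a \<noteq> b" "b \<noteq> c" "a \<noteq> c"
  shows "d = a \<or> d = b \<or> d = c"
  using assms by (cases a; cases b; cases c; cases d) auto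

text \<open>G and every competitor H are instances. The colouring is a parameter because the
  procedure takes it as input.\<close>

locale coloured_map =
  fixes D :: "'d set" and \<alpha> \<sigma> :: "'d \<Rightarrow> 'd" and lab :: "'d \<Rightarrow> 'v" and fc :: "'d set set \<Rightarrow> col"
  assumes cmap: "cmap D \<alpha> \<sigma> lab" and trivalent: "trivalent D \<sigma>"
    and loopless: "loopless D \<alpha> \<sigma>" and proper: "proper_colouring D \<alpha> \<sigma> fc"
begin

abbreviation "\<phi> \<equiv> \<sigma> \<circ> \<alpha>"

definition colour :: "'d \<Rightarrow> col" where
  "colour x = fc (mface \<alpha> \<sigma> x)"

lemma finite_darts: "finite D"
  and bij_alpha: "bij_betw \<alpha> D D" and bij_sigma: "bij_betw \<sigma> D D"
  using cmap unfolding cmap_def by auto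

lemma bij_phi: "bij_betw \<phi> D D"
  using bij_betw_trans[OF bij_alpha bij_sigma] .

lemma alpha_in [simp]: "x \<in> D \<Longrightarrow> \<alpha> x \<in> D"
  and sigma_in [simp]: "x \<in> D \<Longrightarrow> \<sigma> x \<in> D"
  using bij_alpha bij_sigma by (auto simp: bij_betw_def)

lemma alpha_alpha [simp]: "x \<in> D \<Longrightarrow> \<alpha> (\<alpha> x) = x"
  and alpha_neq [simp]: "x \<in> D \<Longrightarrow> \<alpha> x \<noteq> x"
  using cmap unfolding cmap_def by auto

lemma alpha_eq_iff: "x \<in> D \<Longrightarrow> y \<in> D \<Longrightarrow> \<alpha> x = \<alpha> y \<longleftrightarrow> x = y"
  by (metis alpha_alpha)

lemma sigma_eq_iff: "x \<in> D \<Longrightarrow> y \<in> D \<Longrightarrow> \<sigma> x = \<sigma> y \<longleftrightarrow> x = y"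
  using bij_sigma unfolding bij_betw_def inj_on_def by blast

lemma sigma_orbit:
  assumes "x \<in> D"
  shows "\<sigma> (\<sigma> (\<sigma> x)) = x" "orbit \<sigma> x = {x, \<sigma> x, \<sigma> (\<sigma> x)}"
    "\<sigma> x \<noteq> x" "\<sigma> (\<sigma> x) \<noteq> x" "\<sigma> (\<sigma> x) \<noteq> \<sigma> x"
proof -
  have c: "card (orbit \<sigma> x) = 3" using trivalent assms unfolding trivalent_def by blast
  note p = orbit_period[OF finite_darts bij_sigma assms, unfolded c]
  have three: "{..<3::nat} = {0, 1, 2}" by auto
  show "\<sigma> (\<sigma> (\<sigma> x)) = x" using p(1) by (simp add: numeral_3_eq_3)
  show o: "orbit \<sigma> x = {x, \<sigma> x, \<sigma> (\<sigma> x)}" using p(3) unfolding three by (simp add: numeral_2_eq_2)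
  show "\<sigma> x \<noteq> x" "\<sigma> (\<sigma> x) \<noteq> x" "\<sigma> (\<sigma> x) \<noteq> \<sigma> x"
    using c[unfolded o] by (auto simp: card_insert_if split: if_splits)
qed

lemmas sigma3 [simp] = sigma_orbit(1)
lemmas sigma_distinct [simp] = sigma_orbit(3-5) sigma_orbit(3-5)[symmetric]

lemma lab_eq_iff: "x \<in> D \<Longrightarrow> y \<in> D \<Longrightarrow> lab x = lab y \<longleftrightarrow> y \<in> {x, \<sigma> x, \<sigma> (\<sigma> x)}"
  using cmap sigma_orbit(2) unfolding cmap_def by metis

lemma lab_sigma [simp]: "x \<in> D \<Longrightarrow> lab (\<sigma> x) = lab x"
  using lab_eq_iff[of x "\<sigma> x"] by simp

lemma lab_alpha_neq [simp]: "x \<in> D \<Longrightarrow> lab (\<alpha> x) \<noteq> lab x"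
  using loopless lab_eq_iff[of x "\<alpha> x"] sigma_orbit(2) unfolding loopless_def by auto

lemma connected_induct:
  assumes "x \<in> D" "y \<in> D" "P x" "\<And>z. z \<in> D \<Longrightarrow> P z \<Longrightarrow> P (\<sigma> z)" "\<And>z. z \<in> D \<Longrightarrow> P z \<Longrightarrow> P (\<alpha> z)"
  shows "P y"
proof -
  have "(x, y) \<in> ({(x, \<alpha> x) | x. x \<in> D} \<union> {(x, \<sigma> x) | x. x \<in> D})\<^sup>*"
    using cmap assms(1,2) unfolding cmap_def by blast
  then show ?thesis by (induction rule: rtrancl_induct) (use assms in auto)
qed

section \<open>Faces, colours and weights around a vertex\<close>

lemma mface_phi [simp]:
  assumes "x \<in> D"
  shows "mface \<alpha> \<sigma> (\<sigma> (\<alpha> x)) = mface \<alpha> \<sigma> x"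
proof -
  have "\<sigma> (\<alpha> x) \<in> orbit \<phi> x" using orbit_step[OF orbit_self, of \<phi> x] by simp
  then show ?thesis unfolding mface_def using orbit_eq[OF finite_darts bij_phi assms] by metis
qed

text \<open>Since \<open>\<phi> (\<alpha> x) = \<sigma> x\<close>, the face across an edge is the
  next face around the vertex. The simp rules below use this to express face data by the three
  corners at one vertex.\<close>

lemma mface_alpha: "x \<in> D \<Longrightarrow> mface \<alpha> \<sigma> (\<alpha> x) = mface \<alpha> \<sigma> (\<sigma> x)"
  using mface_phi[of "\<alpha> x"] by simp

lemma colour_phi [simp]: "x \<in> D \<Longrightarrow> colour (\<sigma> (\<alpha> x)) = colour x"
  and colour_alpha [simp]: "x \<in> D \<Longrightarrow> colour (\<alpha> x) = colour (\<sigma> x)"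
  and weight_phi [simp]: "x \<in> D \<Longrightarrow> weight \<alpha> \<sigma> (\<sigma> (\<alpha> x)) = weight \<alpha> \<sigma> x"
  and weight_alpha [simp]: "x \<in> D \<Longrightarrow> weight \<alpha> \<sigma> (\<alpha> x) = weight \<alpha> \<sigma> (\<sigma> x)"
  by (simp_all add: colour_def weight_def mface_alpha)

lemma colour_sigma_neq: "x \<in> D \<Longrightarrow> colour (\<sigma> x) \<noteq> colour x"
  using proper unfolding proper_colouring_def colour_def by (metis mface_alpha)

lemma colour_distinct [simp]:
  assumes "x \<in> D"
  shows "colour (\<sigma> x) \<noteq> colour x" "colour (\<sigma> (\<sigma> x)) \<noteq> colour x" "colour (\<sigma> (\<sigma> x)) \<noteq> colour (\<sigma> x)"
    "colour x \<noteq> colour (\<sigma> x)" "colour x \<noteq> colour (\<sigma> (\<sigma> x))" "colour (\<sigma> x) \<noteq> colour (\<sigma> (\<sigma> x))"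
  using colour_sigma_neq[of x] colour_sigma_neq[of "\<sigma> x"] colour_sigma_neq[of "\<sigma> (\<sigma> x)"] assms
  by auto

text \<open>Both ends of an edge see the two colours that border it, so the corner away from the
  edge has the third colour at either end. This is the colour of the edge.\<close>

lemma colour_phi_phi [simp]: "x \<in> D \<Longrightarrow> colour (\<sigma> (\<sigma> (\<alpha> x))) = colour (\<sigma> (\<sigma> x))"
  using col_cases3[of "colour x" "colour (\<sigma> x)" "colour (\<sigma> (\<sigma> x))" "colour (\<sigma> (\<sigma> (\<alpha> x)))"]
    colour_distinct[of x] colour_distinct[of "\<alpha> x"] colour_phi[of x] colour_alpha[of x] by (metis alpha_in)

lemma colour_orbit: "x \<in> D \<Longrightarrow> y \<in> orbit \<phi> x \<Longrightarrow> colour y = colour x"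
  unfolding colour_def mface_def using orbit_eq[OF finite_darts bij_phi] by metis

text \<open>Proper colouring puts different faces on the two sides of an edge. Hence a face runs
  through each of its edges once, and its weight is the length of its dart cycle.\<close>

lemma alpha_notin_face:
  assumes "x \<in> D" "y \<in> orbit \<phi> x"
  shows "\<alpha> y \<notin> orbit \<phi> x"
proof
  assume "\<alpha> y \<in> orbit \<phi> x"
  moreover have "y \<in> D" using orbit_in_domain[OF bij_phi] assms by blast
  ultimately show False using colour_orbit[OF assms(1)] assms(2) colour_alpha[of y] colour_distinct(1)[of y]
    by metis
qed

lemma inj_on_medge_face: "x \<in> D \<Longrightarrow> inj_on (medge \<alpha>) (orbit \<phi> x)"
  using alpha_notin_face by (auto simp: inj_on_def medge_def doubleton_eq_iff)

lemma weight_eq_card: "x \<in> D \<Longrightarrow> weight \<alpha> \<sigma> x = card (orbit \<phi> x)"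
  unfolding weight_def mface_def using card_image inj_on_medge_face by blast

lemma medge_eq_iff: "x \<in> D \<Longrightarrow> y \<in> D \<Longrightarrow> medge \<alpha> x = medge \<alpha> y \<longleftrightarrow> x = y \<or> x = \<alpha> y"
  by (auto simp: medge_def doubleton_eq_iff)

lemma medge_in_mface_iff:
  assumes "x \<in> D" "y \<in> D"
  shows "medge \<alpha> x \<in> mface \<alpha> \<sigma> y \<longleftrightarrow> x \<in> orbit \<phi> y \<or> \<alpha> x \<in> orbit \<phi> y"
proof -
  have "orbit \<phi> y \<subseteq> D" using orbit_in_domain[OF bij_phi assms(2)] .
  then show ?thesis
    unfolding mface_def image_iff using medge_eq_iff[OF assms(1)] assms
    by (metis alpha_alpha subset_iff)
qed

lemma mface_eq_of_orbit: "y \<in> D \<Longrightarrow> x \<in> orbit \<phi> y \<Longrightarrow> mface \<alpha> \<sigma> x = mface \<alpha> \<sigma> y"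
  unfolding mface_def using orbit_eq[OF finite_darts bij_phi] by metis

lemma faces_of_edge:
  assumes "x \<in> D" "y \<in> D"
  shows "medge \<alpha> x \<in> mface \<alpha> \<sigma> y \<longleftrightarrow> mface \<alpha> \<sigma> y = mface \<alpha> \<sigma> x \<or> mface \<alpha> \<sigma> y = mface \<alpha> \<sigma> (\<alpha> x)"
  using medge_in_mface_iff[OF assms] mface_eq_of_orbit[OF assms(2)] orbit_self
    medge_in_mface_iff[OF assms(1) assms(1)] medge_in_mface_iff[OF assms(1) alpha_in[OF assms(1)]]
  by metis

lemma ecol_medge:
  assumes "x \<in> D"
  shows "ecol (map_faces D \<alpha> \<sigma>) fc (medge \<alpha> x) = colour (\<sigma> (\<sigma> x))"
  unfolding ecol_def
proof (rule the_equality)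
  show "\<forall>f\<in>map_faces D \<alpha> \<sigma>. medge \<alpha> x \<in> f \<longrightarrow> fc f \<noteq> colour (\<sigma> (\<sigma> x))"
  proof (intro ballI impI)
    fix f assume "f \<in> map_faces D \<alpha> \<sigma>" "medge \<alpha> x \<in> f"
    then have "f = mface \<alpha> \<sigma> x \<or> f = mface \<alpha> \<sigma> (\<sigma> x)"
      unfolding map_faces_def using faces_of_edge[OF assms] mface_alpha[OF assms] by auto
    then have "fc f = colour x \<or> fc f = colour (\<sigma> x)" unfolding colour_def by auto
    then show "fc f \<noteq> colour (\<sigma> (\<sigma> x))" using colour_distinct[OF assms] by auto
  qed
  fix c assume c: "\<forall>f\<in>map_faces D \<alpha> \<sigma>. medge \<alpha> x \<in> f \<longrightarrow> fc f \<noteq> c"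
  have "c \<noteq> colour x" "c \<noteq> colour (\<sigma> x)"
    using c assms faces_of_edge[OF assms] mface_alpha[OF assms] unfolding map_faces_def colour_def
    by (metis imageI, metis imageI sigma_in)
  then show "c = colour (\<sigma> (\<sigma> x))"
    using col_cases3[of "colour x" "colour (\<sigma> x)" "colour (\<sigma> (\<sigma> x))" c] colour_distinct[OF assms] by auto
qed

text \<open>Crossing an edge reverses the cyclic order of the three colours, so this is a bipartition.\<close>
definition positive :: "'d \<Rightarrow> bool" where
  "positive x \<longleftrightarrow> colour (\<sigma> x) = next_col (colour x)"

lemma positive_sigma: "x \<in> D \<Longrightarrow> positive (\<sigma> x) \<longleftrightarrow> positive x"
  unfolding positive_def using colour_distinct[of x]
  by (cases "colour x"; cases "colour (\<sigma> x)"; cases "colour (\<sigma> (\<sigma> x))") auto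

lemma positive_alpha: "x \<in> D \<Longrightarrow> positive (\<alpha> x) \<longleftrightarrow> \<not> positive x"
  unfolding positive_def using colour_distinct[of x]
  by (cases "colour x"; cases "colour (\<sigma> x)") auto

lemma positive_lab: "x \<in> D \<Longrightarrow> y \<in> D \<Longrightarrow> lab x = lab y \<Longrightarrow> positive x = positive y"
  using lab_eq_iff[of x y] positive_sigma[of x] positive_sigma[of "\<sigma> x"] by auto

text \<open>If the edges of \<open>x\<close> and \<open>\<sigma> x\<close> had the same far end,
  \<open>\<alpha> (\<sigma> x)\<close> would be one of the three darts there. Injectivity excludes
  \<open>\<alpha> x\<close>, colours exclude \<open>\<sigma> (\<alpha> x)\<close>, and the last
  choice makes \<open>\<alpha> x\<close> and \<open>\<sigma> x\<close> bound a digon.\<close>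

lemma no_parallel_sigma:
  assumes w: "\<And>x. x \<in> D \<Longrightarrow> weight \<alpha> \<sigma> x \<ge> 3" and x: "x \<in> D"
  shows "lab (\<alpha> x) \<noteq> lab (\<alpha> (\<sigma> x))"
proof
  assume "lab (\<alpha> x) = lab (\<alpha> (\<sigma> x))"
  then have "\<alpha> (\<sigma> x) \<in> {\<alpha> x, \<sigma> (\<alpha> x), \<sigma> (\<sigma> (\<alpha> x))}" using lab_eq_iff[of "\<alpha> x" "\<alpha> (\<sigma> x)"] x by auto
  moreover have "\<alpha> (\<sigma> x) \<noteq> \<alpha> x" using alpha_eq_iff[of "\<sigma> x" x] x by simp
  moreover have "\<alpha> (\<sigma> x) \<noteq> \<sigma> (\<alpha> x)"
    by (metis colour_alpha colour_phi colour_distinct(2) sigma_in x)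
  ultimately have e: "\<alpha> (\<sigma> x) = \<sigma> (\<sigma> (\<alpha> x))" by blast
  have "orbit \<phi> (\<alpha> x) \<subseteq> {\<alpha> x, \<sigma> x}"
    by (rule orbit_subset) (use x e in auto)
  then have "card (orbit \<phi> (\<alpha> x)) \<le> card {\<alpha> x, \<sigma> x}" by (intro card_mono) auto
  also have "\<dots> \<le> 2" by (simp add: card_insert_if)
  finally show False using w[of "\<alpha> x"] weight_eq_card[of "\<alpha> x"] x by simp
qed

lemma no_parallel:
  assumes w: "\<And>x. x \<in> D \<Longrightarrow> weight \<alpha> \<sigma> x \<ge> 3" and "x \<in> D" "y \<in> D" "lab x = lab y" "lab (\<alpha> x) = lab (\<alpha> y)"
  shows "x = y"
  using lab_eq_iff[of x y] no_parallel_sigma[OF w, of x] no_parallel_sigma[OF w, of y] assms by auto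

lemma no_parallel_medge:
  assumes w: "\<And>x. x \<in> D \<Longrightarrow> weight \<alpha> \<sigma> x \<ge> 3" and "x \<in> D" "y \<in> D" "{lab x, lab (\<alpha> x)} = {lab y, lab (\<alpha> y)}"
  shows "medge \<alpha> x = medge \<alpha> y"
  using no_parallel[OF w, of x y] no_parallel[OF w, of x "\<alpha> y"] assms medge_eq_iff[of x y]
  by (auto simp: doubleton_eq_iff)

text \<open>A vertex configuration gives the weights only as a multiset. Which colour carries which
  weight is propagated along edges by connectedness.\<close>

lemma weight_by_colour:
  assumes "of_type T D \<alpha> \<sigma>"
  obtains W where "\<And>x. x \<in> D \<Longrightarrow> weight \<alpha> \<sigma> x = W (colour x)"
proof (cases "D = {}")
  case True then show ?thesis using that by simp
next
  case False
  then obtain d where d: "d \<in> D" by blast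
  let ?w = "weight \<alpha> \<sigma>"
  have sort3: "a + b + c = x + y + z" if "sort [a, b, c] = [x, y, z]" for a b c x y z :: nat
    using that by (auto split: if_splits)
  obtain s where s: "?w x + ?w (\<sigma> x) + ?w (\<sigma> (\<sigma> x)) = s" if "x \<in> D" for x
  proof (rule that[of "sum_list (config_of T)"])
    fix x assume "x \<in> D"
    then have "sort [?w x, ?w (\<sigma> x), ?w (\<sigma> (\<sigma> x))] = config_of T"
      using assms unfolding of_type_def vertex_config_def by simp
    then show "?w x + ?w (\<sigma> x) + ?w (\<sigma> (\<sigma> x)) = sum_list (config_of T)"
      using sort3 by (cases T) (auto simp del: sort_key_simps)
  qed
  define W where "W = (\<lambda>c. if c = colour d then ?w d else if c = colour (\<sigma> d) then ?w (\<sigma> d) else ?w (\<sigma> (\<sigma> d)))"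
  have "?w x = W (colour x) \<and> ?w (\<sigma> x) = W (colour (\<sigma> x)) \<and> ?w (\<sigma> (\<sigma> x)) = W (colour (\<sigma> (\<sigma> x)))"
    if "x \<in> D" for x
    using d that
  proof (rule connected_induct)
    show "?w d = W (colour d) \<and> ?w (\<sigma> d) = W (colour (\<sigma> d)) \<and> ?w (\<sigma> (\<sigma> d)) = W (colour (\<sigma> (\<sigma> d)))"
      using d by (simp add: W_def)
    fix z assume z: "z \<in> D"
      and h: "?w z = W (colour z) \<and> ?w (\<sigma> z) = W (colour (\<sigma> z)) \<and> ?w (\<sigma> (\<sigma> z)) = W (colour (\<sigma> (\<sigma> z)))"
    show "?w (\<sigma> z) = W (colour (\<sigma> z)) \<and> ?w (\<sigma> (\<sigma> z)) = W (colour (\<sigma> (\<sigma> z)))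
      \<and> ?w (\<sigma> (\<sigma> (\<sigma> z))) = W (colour (\<sigma> (\<sigma> (\<sigma> z))))" using z h by simp
    \<comment> \<open>The ends of an edge share two faces and have the same weight total, so their
      third weights agree too.\<close>
    have "?w (\<sigma> (\<sigma> (\<alpha> z))) = ?w (\<sigma> (\<sigma> z))"
      using s[of z] s[of "\<alpha> z"] z by simp
    then show "?w (\<alpha> z) = W (colour (\<alpha> z)) \<and> ?w (\<sigma> (\<alpha> z)) = W (colour (\<sigma> (\<alpha> z)))
      \<and> ?w (\<sigma> (\<sigma> (\<alpha> z))) = W (colour (\<sigma> (\<sigma> (\<alpha> z))))" using z h by simp
  qed
  then show ?thesis using that by blast
qed

end

section \<open>The defective-edge procedure\<close>

text \<open>The three disjuncts are the three kinds of face on which an old edge can survive: an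
  untouched face, a new digon, the merged face.\<close>

lemma Inl_in_defective_edge_iff:
  fixes E :: "'e set" and F :: "'e set set" and f :: 'e
  assumes E: "f \<in> E" and B: "third (fc S) (ecol F fc e) = B"
  defines "merge \<equiv> {M \<in> F. fc M = B \<and> M \<inter> S \<noteq> {}}"
  shows "Inl f \<in> fst (defective_edge E ends F fc e S) \<longleftrightarrow>
    (\<exists>M \<in> F - {S} - merge. f \<in> M) \<or> (f \<in> S \<and> ecol F fc f = B) \<or> ((\<exists>M \<in> merge. f \<in> M) \<and> f \<notin> S)"
proof -
  define BS where "BS = {f \<in> S. ecol F fc f = B}"
  define F1 F2 F3 where "F1 = (\<lambda>M. Inl ` M :: ('e + 'e) set) ` (F - {S} - merge)"
    and "F2 = (\<lambda>f. {Inl f, Inr f :: 'e + 'e}) ` BS"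
    and "F3 = Inr ` BS \<union> (Inl ` (\<Union>merge - S) :: ('e + 'e) set)"
  have "fst (defective_edge E ends F fc e S) = {x \<in> Inl ` E \<union> Inr ` BS. \<exists>M \<in> F1 \<union> F2 \<union> {F3}. x \<in> M}"
    unfolding defective_edge_def Let_def B F1_def F2_def F3_def BS_def merge_def by simp
  moreover have "(\<exists>M \<in> F1. Inl f \<in> M) \<longleftrightarrow> (\<exists>M \<in> F - {S} - merge. f \<in> M)" unfolding F1_def by auto
  moreover have "(\<exists>M \<in> F2. Inl f \<in> M) \<longleftrightarrow> f \<in> S \<and> ecol F fc f = B" unfolding F2_def BS_def by auto
  moreover have "Inl f \<in> F3 \<longleftrightarrow> (\<exists>M \<in> merge. f \<in> M) \<and> f \<notin> S" unfolding F3_def by auto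
  ultimately show ?thesis using E by auto
qed

lemma Inr_in_defective_edge:
  "Inr f \<in> fst (defective_edge E ends F fc e S) \<Longrightarrow> f \<in> S \<and> ecol F fc f = third (fc S) (ecol F fc e)"
  unfolding defective_edge_def Let_def fst_conv by blast

section \<open>Adjacencies removed by the procedure\<close>

context coloured_map begin

lemma bij_phi_orbit:
  assumes "x \<in> D"
  shows "bij_betw \<phi> (orbit \<phi> x) (orbit \<phi> x)"
proof -
  have sub: "orbit \<phi> x \<subseteq> D" by (rule orbit_in_domain[OF bij_phi assms])
  have "inj_on \<phi> (orbit \<phi> x)" using bij_phi sub inj_on_subset unfolding bij_betw_def by blast
  moreover have "\<phi> ` orbit \<phi> x \<subseteq> orbit \<phi> x" using orbit_step[of _ \<phi> x] by blast
  ultimately show ?thesis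
    using endo_inj_surj[OF finite_subset[OF sub finite_darts]] unfolding bij_betw_def by blast
qed

text \<open>One step along a face exchanges the two colours available to its edges, so
  \<open>\<phi>\<close> maps the edges of one colour bijectively to those of the other.\<close>

lemma card_face_edges_of_colour:
  assumes s: "s \<in> D" and c: "c \<noteq> colour s"
  shows "card (orbit \<phi> s) = 2 * card {x \<in> orbit \<phi> s. colour (\<sigma> (\<sigma> x)) = c}"
proof -
  define O1 where "O1 = {x \<in> orbit \<phi> s. colour (\<sigma> (\<sigma> x)) = c}"
  define O2 where "O2 = {x \<in> orbit \<phi> s. \<phi> x \<in> O1}"
  have sub: "orbit \<phi> s \<subseteq> D" by (rule orbit_in_domain[OF bij_phi s])
  have fin: "finite (orbit \<phi> s)" using finite_subset[OF sub finite_darts] .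
  have O2: "x \<in> O2 \<longleftrightarrow> x \<notin> O1" if x: "x \<in> orbit \<phi> s" for x
  proof -
    have xD: "x \<in> D" using sub x by blast
    have "colour (\<sigma> (\<sigma> (\<phi> x))) = colour (\<sigma> x)" using xD by simp
    moreover have "\<phi> x \<in> orbit \<phi> s" using orbit_step[OF x] .
    ultimately have "x \<in> O2 \<longleftrightarrow> colour (\<sigma> x) = c" unfolding O1_def O2_def using x by auto
    moreover have "c \<noteq> colour x" using colour_orbit[OF s x] c by simp
    ultimately show ?thesis unfolding O1_def using x xD colour_distinct[OF xD]
        col_cases3[of "colour x" "colour (\<sigma> x)" "colour (\<sigma> (\<sigma> x))" c] by auto
  qed
  have dec: "orbit \<phi> s = O1 \<union> O2" "O1 \<inter> O2 = {}" using O2 unfolding O1_def O2_def by auto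
  have b: "bij_betw \<phi> (orbit \<phi> s) (orbit \<phi> s)" by (rule bij_phi_orbit[OF s])
  have "\<phi> ` O2 = O1"
  proof
    show "\<phi> ` O2 \<subseteq> O1" unfolding O2_def by auto
    show "O1 \<subseteq> \<phi> ` O2"
    proof
      fix y assume y: "y \<in> O1"
      then have "y \<in> \<phi> ` orbit \<phi> s" using b dec(1) unfolding bij_betw_def by blast
      then obtain x where x: "x \<in> orbit \<phi> s" "y = \<phi> x" by (rule imageE)
      then have "x \<in> O2" using y unfolding O2_def by blast
      with x(2) show "y \<in> \<phi> ` O2" by (rule image_eqI)
    qed
  qed
  moreover have "inj_on \<phi> O2" using b inj_on_subset dec(1) unfolding bij_betw_def by blast
  ultimately have "card O1 = card O2" using card_image by metis
  moreover have "card (orbit \<phi> s) = card O1 + card O2"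
    using dec fin by (metis card_Un_disjoint finite_Un)
  ultimately show ?thesis unfolding O1_def by simp
qed

text \<open>Here \<open>colour (\<sigma> (\<sigma> x))\<close> is the colour of the edge of x, so
  this holds one dart, on the side of the shrink face, for each edge of that face with the colour of
  e.\<close>

definition removed_darts :: "'d \<Rightarrow> 'd set" where
  "removed_darts s = {x \<in> orbit \<phi> s. colour (\<sigma> (\<sigma> x)) = colour (\<sigma> (\<sigma> s))}"

lemma removed_darts_subset: "s \<in> D \<Longrightarrow> removed_darts s \<subseteq> D"
  unfolding removed_darts_def using orbit_in_domain[OF bij_phi] by blast

text \<open>A single dart \<open>s\<close> encodes the input: its edge is the defective edge and its
  face is the shrink face.\<close>

context
  fixes s :: 'd and G' :: "('d set + 'd set) set \<times> (('d set + 'd set) \<Rightarrow> 'v set)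
    \<times> ('d set + 'd set) set set \<times> (('d set + 'd set) set \<Rightarrow> col)"
  assumes s: "s \<in> D"
    and G': "G' = defective_edge (map_edges D \<alpha>) (\<lambda>\<epsilon>. lab ` \<epsilon>) (map_faces D \<alpha> \<sigma>) fc (medge \<alpha> s) (mface \<alpha> \<sigma> s)"
begin

lemma third_colour: "third (fc (mface \<alpha> \<sigma> s)) (ecol (map_faces D \<alpha> \<sigma>) fc (medge \<alpha> s)) = colour (\<sigma> s)"
  using s by (auto simp: ecol_medge colour_def[symmetric] intro: third_eqI)

lemma shrink_face_edge:
  assumes "f \<in> mface \<alpha> \<sigma> s"
  obtains x where "x \<in> orbit \<phi> s" "x \<in> D" "f = medge \<alpha> x" "colour x = colour s" "mface \<alpha> \<sigma> x = mface \<alpha> \<sigma> s"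
    "ecol (map_faces D \<alpha> \<sigma>) fc f = colour (\<sigma> (\<sigma> x))"
proof -
  obtain x where x: "x \<in> orbit \<phi> s" "f = medge \<alpha> x" using assms unfolding mface_def by auto
  have xD: "x \<in> D" using orbit_in_domain[OF bij_phi s] x(1) by blast
  have "ecol (map_faces D \<alpha> \<sigma>) fc f = colour (\<sigma> (\<sigma> x))" unfolding x(2) by (rule ecol_medge[OF xD])
  with x(1) xD x(2) colour_orbit[OF s x(1)] mface_eq_of_orbit[OF s x(1)] show ?thesis by (rule that)
qed

lemma removed_edge_iff:
  assumes "d \<in> D"
  shows "medge \<alpha> d \<in> medge \<alpha> ` removed_darts s \<longleftrightarrow>
    medge \<alpha> d \<in> mface \<alpha> \<sigma> s \<and> ecol (map_faces D \<alpha> \<sigma>) fc (medge \<alpha> d) = colour (\<sigma> (\<sigma> s))"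
proof
  assume "medge \<alpha> d \<in> medge \<alpha> ` removed_darts s"
  then obtain x where x: "x \<in> orbit \<phi> s" "colour (\<sigma> (\<sigma> x)) = colour (\<sigma> (\<sigma> s))" "medge \<alpha> d = medge \<alpha> x"
    unfolding removed_darts_def by auto
  have "x \<in> D" using orbit_in_domain[OF bij_phi s] x(1) by blast
  then show "medge \<alpha> d \<in> mface \<alpha> \<sigma> s \<and> ecol (map_faces D \<alpha> \<sigma>) fc (medge \<alpha> d) = colour (\<sigma> (\<sigma> s))"
    using x ecol_medge unfolding mface_def by auto
next
  assume a: "medge \<alpha> d \<in> mface \<alpha> \<sigma> s \<and> ecol (map_faces D \<alpha> \<sigma>) fc (medge \<alpha> d) = colour (\<sigma> (\<sigma> s))"
  from conjunct1[OF a] obtain x where x: "x \<in> orbit \<phi> s" "medge \<alpha> d = medge \<alpha> x"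
    "ecol (map_faces D \<alpha> \<sigma>) fc (medge \<alpha> d) = colour (\<sigma> (\<sigma> x))"
    by (rule shrink_face_edge)
  have "x \<in> removed_darts s" using a x(1,3) unfolding removed_darts_def by simp
  with x(2) show "medge \<alpha> d \<in> medge \<alpha> ` removed_darts s" by (rule image_eqI)
qed

text \<open>An edge off the shrink face lies on another face, untouched or merged. An edge of the
  shrink face with the colour of the merge faces survives in its digon. Any other edge of the shrink
  face borders only that face and a merge face, and the merged face omits the edges of the shrink
  face.\<close>

lemma old_edge_kept_iff:
  assumes d: "d \<in> D"
  shows "Inl (medge \<alpha> d) \<in> fst G' \<longleftrightarrow> medge \<alpha> d \<notin> medge \<alpha> ` removed_darts s"
proof -
  let ?F = "map_faces D \<alpha> \<sigma>" and ?S = "mface \<alpha> \<sigma> s" and ?B = "colour (\<sigma> s)" and ?f = "medge \<alpha> d"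
  let ?ec = "ecol ?F fc"
  let ?merge = "{M \<in> ?F. fc M = ?B \<and> M \<inter> ?S \<noteq> {}}"
  have fE: "?f \<in> map_edges D \<alpha>" using d unfolding map_edges_def by auto
  have iff: "Inl ?f \<in> fst G' \<longleftrightarrow>
     (\<exists>M \<in> ?F - {?S} - ?merge. ?f \<in> M) \<or> (?f \<in> ?S \<and> ?ec ?f = ?B) \<or> ((\<exists>M \<in> ?merge. ?f \<in> M) \<and> ?f \<notin> ?S)"
    unfolding G' by (rule Inl_in_defective_edge_iff[OF fE third_colour])
  show ?thesis
  proof (cases "?f \<in> ?S")
    case False
    have F: "mface \<alpha> \<sigma> d \<in> ?F" unfolding map_faces_def using d by (rule imageI)
    have f: "?f \<in> mface \<alpha> \<sigma> d" using faces_of_edge[OF d d] by simp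
    then have "mface \<alpha> \<sigma> d \<noteq> ?S" using False by metis
    then have "Inl ?f \<in> fst G'" unfolding iff using False F f by (cases "mface \<alpha> \<sigma> d \<in> ?merge") blast+
    then show ?thesis using False removed_edge_iff[OF d] by blast
  next
    case True
    then obtain x where x: "x \<in> orbit \<phi> s" "x \<in> D" "?f = medge \<alpha> x" "colour x = colour s"
      "mface \<alpha> \<sigma> x = ?S" "?ec ?f = colour (\<sigma> (\<sigma> x))" by (rule shrink_face_edge)
    have cx: "colour (\<sigma> (\<sigma> x)) = ?B \<or> colour (\<sigma> (\<sigma> x)) = colour (\<sigma> (\<sigma> s))"
      using col_cases3[of "colour s" "colour (\<sigma> s)" "colour (\<sigma> (\<sigma> s))" "colour (\<sigma> (\<sigma> x))"]
        colour_distinct[OF s] colour_distinct[OF x(2)] x(4) by metis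
    show ?thesis
    proof (cases "colour (\<sigma> (\<sigma> x)) = ?B")
      case True
      then have "Inl ?f \<in> fst G'" unfolding iff using x(6) \<open>?f \<in> ?S\<close> by auto
      moreover have "?f \<notin> medge \<alpha> ` removed_darts s"
        using removed_edge_iff[OF d] x(6) True colour_distinct[OF s] by simp
      ultimately show ?thesis by blast
    next
      case False
      have B: "colour (\<sigma> x) = ?B"
        using cx False col_cases3[of "colour s" "colour (\<sigma> s)" "colour (\<sigma> (\<sigma> s))" "colour (\<sigma> x)"]
        colour_distinct[OF s] colour_distinct[OF x(2)] x(4) by metis
      have M: "M = ?S \<or> M \<in> ?merge" if "M \<in> ?F" "?f \<in> M" for M
      proof -
        have "M = mface \<alpha> \<sigma> x \<or> M = mface \<alpha> \<sigma> (\<sigma> x)"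
          using that faces_of_edge[OF x(2)] mface_alpha[OF x(2)] unfolding x(3) map_faces_def by auto
        then show ?thesis using that \<open>?f \<in> ?S\<close> B x(5) unfolding colour_def by auto
      qed
      then have "Inl ?f \<notin> fst G'" unfolding iff using True False x(6) by auto
      moreover have "?f \<in> medge \<alpha> ` removed_darts s"
        using removed_edge_iff[OF d] x(6) True False cx by simp
      ultimately show ?thesis by blast
    qed
  qed
qed

text \<open>Each new edge doubles an old edge that is kept, so new edges neither create nor rescue
  an adjacency.\<close>

lemma new_edge_parallel:
  assumes "Inr f \<in> fst G'"
  obtains d where "d \<in> D" "f = medge \<alpha> d" "medge \<alpha> d \<notin> medge \<alpha> ` removed_darts s"
proof -
  have "f \<in> mface \<alpha> \<sigma> s \<and> ecol (map_faces D \<alpha> \<sigma>) fc f = colour (\<sigma> s)"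
    using Inr_in_defective_edge[OF assms[unfolded G'], unfolded third_colour] .
  then obtain d where "d \<in> D" "f = medge \<alpha> d" "ecol (map_faces D \<alpha> \<sigma>) fc f = colour (\<sigma> s)"
    using shrink_face_edge by metis
  then show ?thesis using that removed_edge_iff[of d] colour_distinct[OF s] by metis
qed

lemma output_adjacency:
  "ms_adj (fst G') (fst (snd G')) x y \<longleftrightarrow>
    (\<exists>d\<in>D. {lab d, lab (\<alpha> d)} = {x, y} \<and> medge \<alpha> d \<notin> medge \<alpha> ` removed_darts s)"
proof
  have ends: "fst (snd G') = case_sum (\<lambda>\<epsilon>. lab ` \<epsilon>) (\<lambda>\<epsilon>. lab ` \<epsilon>)"
    unfolding G' defective_edge_def Let_def by simp
  have le: "lab ` medge \<alpha> d = {lab d, lab (\<alpha> d)}" for d unfolding medge_def by auto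
  {
    assume "ms_adj (fst G') (fst (snd G')) x y"
    then obtain \<epsilon> where e: "\<epsilon> \<in> fst G'" "fst (snd G') \<epsilon> = {x, y}" unfolding ms_adj_def by blast
    show "\<exists>d\<in>D. {lab d, lab (\<alpha> d)} = {x, y} \<and> medge \<alpha> d \<notin> medge \<alpha> ` removed_darts s"
    proof (cases \<epsilon>)
      case (Inl f)
      then have "f \<in> map_edges D \<alpha>"
        using e(1) unfolding G' defective_edge_def Let_def fst_conv by blast
      then obtain d where "d \<in> D" "f = medge \<alpha> d" unfolding map_edges_def by blast
      then show ?thesis using e Inl old_edge_kept_iff ends le by (metis old.sum.simps(5))
    next
      case (Inr f)
      then show ?thesis using e new_edge_parallel ends le by (metis old.sum.simps(6))
    qed
  next
    assume "\<exists>d\<in>D. {lab d, lab (\<alpha> d)} = {x, y} \<and> medge \<alpha> d \<notin> medge \<alpha> ` removed_darts s"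
    then obtain d where d: "d \<in> D" "{lab d, lab (\<alpha> d)} = {x, y}" "Inl (medge \<alpha> d) \<in> fst G'"
      using old_edge_kept_iff by blast
    show "ms_adj (fst G') (fst (snd G')) x y"
      unfolding ms_adj_def
      by (rule bexI[OF _ d(3)]) (simp add: ends le d(2))
  }
qed

text \<open>Without parallel edges, each removed edge is a removed adjacency. Half of the edges of
  the shrink face are removed, and \<open>Rcount\<close> leaves out one of them, the defective edge
  itself.\<close>

lemma Rcount_output:
  assumes w: "\<And>x. x \<in> D \<Longrightarrow> weight \<alpha> \<sigma> x \<ge> 3"
  shows "Rcount (map_adj D \<alpha> lab) (ms_adj (fst G') (fst (snd G'))) (lab s) (lab (\<alpha> s)) = (weight \<alpha> \<sigma> s - 2) div 2"
proof -
  let ?pair = "\<lambda>d. {lab d, lab (\<alpha> d)}"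
  let ?Z = "{p. \<exists>x y. p = {x, y} \<and> map_adj D \<alpha> lab x y \<and> \<not> ms_adj (fst G') (fst (snd G')) x y}"
  note sub = removed_darts_subset[OF s]
  have "?Z = ?pair ` removed_darts s"
  proof (intro set_eqI iffI)
    fix p assume "p \<in> ?Z"
    then obtain x y where p: "p = {x, y}" "map_adj D \<alpha> lab x y"
      "\<not> ms_adj (fst G') (fst (snd G')) x y" by blast
    then obtain d where d: "d \<in> D" "?pair d = {x, y}" unfolding map_adj_def by blast
    then have "medge \<alpha> d \<in> medge \<alpha> ` removed_darts s" using p(3) unfolding output_adjacency by blast
    then obtain z where z: "z \<in> removed_darts s" "medge \<alpha> d = medge \<alpha> z" by blast
    moreover have "z \<in> D" using z(1) sub by blast
    ultimately have "?pair d = ?pair z" using medge_eq_iff[OF d(1), of z] by auto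
    then show "p \<in> ?pair ` removed_darts s" using p(1) d(2) z(1) by blast
  next
    fix p assume "p \<in> ?pair ` removed_darts s"
    then obtain z where z: "z \<in> removed_darts s" "p = ?pair z" by blast
    then have "z \<in> D" using sub by blast
    then have "map_adj D \<alpha> lab (lab z) (lab (\<alpha> z))" unfolding map_adj_def by blast
    moreover have "\<not> ms_adj (fst G') (fst (snd G')) (lab z) (lab (\<alpha> z))"
      unfolding output_adjacency using no_parallel_medge[OF w _ \<open>z \<in> D\<close>] z(1) by blast
    ultimately show "p \<in> ?Z" using z(2) by blast
  qed
  moreover have "inj_on ?pair (removed_darts s)"
  proof (rule inj_onI)
    fix x y assume xy: "x \<in> removed_darts s" "y \<in> removed_darts s" "?pair x = ?pair y"
    then have "medge \<alpha> x = medge \<alpha> y" using no_parallel_medge[OF w] sub by blast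
    then show "x = y" using xy inj_on_medge_face[OF s] unfolding removed_darts_def inj_on_def by blast
  qed
  moreover have "s \<in> removed_darts s" unfolding removed_darts_def using orbit_self by auto
  moreover have "finite (removed_darts s)" using sub finite_darts finite_subset by blast
  moreover have "weight \<alpha> \<sigma> s = 2 * card (removed_darts s)"
    using card_face_edges_of_colour[OF s, of "colour (\<sigma> (\<sigma> s))"] colour_distinct[OF s] weight_eq_card[OF s]
    unfolding removed_darts_def by simp
  ultimately show ?thesis unfolding Rcount_def by (simp add: card_image card_Diff_singleton_if)
qed

end

end

section \<open>Regions bounded by a cycle\<close>

text \<open>The word lists the turns along a cycle, True for left. In the state (l, r, t) the current dart
has a face of colour l to its left, one of colour r to its right, and t is the third colour. At a
left turn the region to the left has a single corner, of colour l; at a right turn it has two, of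
colours l and t.\<close>
fun corner_count :: "col \<Rightarrow> col \<Rightarrow> col \<Rightarrow> col \<Rightarrow> bool list \<Rightarrow> nat" where
  "corner_count k l r t [] = 0"
| "corner_count k l r t (True # w) = of_bool (l = k) + corner_count k l t r w"
| "corner_count k l r t (False # w) = of_bool (l = k) + of_bool (t = k) + corner_count k t r l w"

lemma mod_Suc_cancel: "Suc i mod n = Suc j mod n \<Longrightarrow> i mod n = j mod (n::nat)"
  by (auto simp: mod_Suc split: if_splits)

text \<open>The assumption \<open>start\<close> fixes the side: the region lies to the left of the
  cycle. A region on the right is replaced by its complement when the locale is
  instantiated.\<close>

locale bounded_region = coloured_map D \<alpha> \<sigma> lab fc
  for D :: "'d set" and \<alpha> \<sigma> :: "'d \<Rightarrow> 'd" and lab :: "'d \<Rightarrow> 'v" and fc :: "'d set set \<Rightarrow> col" +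
  fixes ds :: "'d list" and X :: "'d set"
  assumes cycle: "is_cycle D \<alpha> lab ds" and X_subset: "X \<subseteq> D"
    and X_closed: "\<And>x. x \<in> X \<Longrightarrow> \<sigma> (\<alpha> x) \<in> X"
    and boundary: "\<And>d. d \<in> D \<Longrightarrow> medge \<alpha> d \<in> medge \<alpha> ` set ds \<longleftrightarrow> (d \<in> X) \<noteq> (\<alpha> d \<in> X)"
    and start: "ds ! 0 \<in> X"
begin

section \<open>The course of the boundary cycle\<close>

definition c :: "nat \<Rightarrow> 'd" where "c j = ds ! (j mod length ds)"

text \<open>\<open>\<phi>\<close> continues along the face to the left of a dart, and at a trivalent
  vertex this is the left turn.\<close>

definition left :: "nat \<Rightarrow> bool" where "left j \<longleftrightarrow> c (Suc j) = \<sigma> (\<alpha> (c j))"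

lemma length_ge: "length ds \<ge> 2"
  using cycle unfolding is_cycle_def by blast

lemma c_in_set: "c j \<in> set ds"
  unfolding c_def using length_ge by (intro nth_mem mod_less_divisor) linarith

lemma c_in: "c j \<in> D"
  using c_in_set cycle unfolding is_cycle_def by blast

lemma in_set_c: "x \<in> set ds \<longleftrightarrow> (\<exists>j. x = c j)"
  using c_in_set unfolding c_def in_set_conv_nth by (metis mod_less)

lemma lab_alpha_c: "lab (\<alpha> (c j)) = lab (c (Suc j))"
proof -
  have "j mod length ds < length ds" using length_ge by (intro mod_less_divisor) linarith
  then have "lab (\<alpha> (ds ! (j mod length ds))) = lab (ds ! ((j mod length ds + 1) mod length ds))"
    using cycle unfolding is_cycle_def by blast
  then show ?thesis unfolding c_def by (simp add: mod_Suc_eq)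
qed

lemma lab_c_eq: "lab (c i) = lab (c j) \<Longrightarrow> i mod length ds = j mod length ds"
  and medge_c_eq: "medge \<alpha> (c i) = medge \<alpha> (c j) \<Longrightarrow> i mod length ds = j mod length ds"
proof -
  have l: "i mod length ds < length ds" "j mod length ds < length ds"
    using length_ge by (auto intro!: mod_less_divisor)
  show "i mod length ds = j mod length ds" if "lab (c i) = lab (c j)"
    using nth_eq_iff_index_eq[of "map lab ds" "i mod length ds" "j mod length ds"] that cycle l
    unfolding c_def is_cycle_def by simp
  show "i mod length ds = j mod length ds" if "medge \<alpha> (c i) = medge \<alpha> (c j)"
    using nth_eq_iff_index_eq[of "map (medge \<alpha>) ds" "i mod length ds" "j mod length ds"] that cycle l
    unfolding c_def is_cycle_def by simp
qed

lemma c_mod: "i mod length ds = j mod length ds \<Longrightarrow> c i = c j"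
  unfolding c_def by simp

lemma Suc_mod_neq: "Suc j mod length ds \<noteq> j mod length ds"
  using length_ge by (auto simp: mod_Suc)

lemma turn: "\<not> left j \<Longrightarrow> c (Suc j) = \<sigma> (\<sigma> (\<alpha> (c j)))"
proof -
  assume "\<not> left j"
  \<comment> \<open>Turning straight back would repeat an edge of the cycle.\<close>
  moreover have "c (Suc j) \<noteq> \<alpha> (c j)"
    using medge_c_eq[of "Suc j" j] Suc_mod_neq medge_eq_iff[OF c_in c_in] by blast
  ultimately show ?thesis
    using lab_eq_iff[of "\<alpha> (c j)" "c (Suc j)"] lab_alpha_c[of j] c_in unfolding left_def by auto
qed

lemma X_in: "x \<in> X \<Longrightarrow> x \<in> D"
  using X_subset by blast

lemma finite_X: "finite X"
  using X_subset finite_darts finite_subset by blast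

lemma bij_phi_X: "bij_betw \<phi> X X"
proof -
  have "inj_on \<phi> X" using bij_phi X_subset inj_on_subset unfolding bij_betw_def by blast
  moreover have "\<phi> ` X \<subseteq> X" using X_closed by auto
  ultimately show ?thesis using endo_inj_surj[OF finite_X] unfolding bij_betw_def by blast
qed

lemma phi_in_X_iff: "x \<in> D \<Longrightarrow> \<sigma> (\<alpha> x) \<in> X \<longleftrightarrow> x \<in> X"
proof
  assume x: "x \<in> D" "\<sigma> (\<alpha> x) \<in> X"
  then obtain y where "y \<in> X" "\<sigma> (\<alpha> x) = \<sigma> (\<alpha> y)"
    using bij_phi_X unfolding bij_betw_def by (metis comp_apply imageE)
  then show "x \<in> X" using x X_in[of y] sigma_eq_iff[of "\<alpha> x" "\<alpha> y"] alpha_eq_iff[of x y] by auto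
qed (rule X_closed)

lemma interior_edge:
  assumes "x \<in> D" "medge \<alpha> x \<notin> medge \<alpha> ` set ds"
  shows "\<alpha> x \<in> X \<longleftrightarrow> x \<in> X" "\<sigma> x \<in> X \<longleftrightarrow> x \<in> X"
proof -
  show 1: "\<alpha> x \<in> X \<longleftrightarrow> x \<in> X" using boundary assms by blast
  show "\<sigma> x \<in> X \<longleftrightarrow> x \<in> X" using phi_in_X_iff[of "\<alpha> x"] assms 1 by simp
qed

lemma boundary_edge:
  assumes "x \<in> D" "medge \<alpha> x \<in> medge \<alpha> ` set ds"
  obtains i where "x = c i \<or> x = \<alpha> (c i)"
proof -
  obtain y where "y \<in> set ds" "medge \<alpha> x = medge \<alpha> y" using assms(2) by blast
  moreover from this obtain i where "y = c i" using in_set_c by blast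
  ultimately show ?thesis using that medge_eq_iff[OF assms(1) c_in] by blast
qed

text \<open>As the vertices of the cycle are distinct, only the entering and the leaving edge at a
  vertex belong to it. The third edge therefore has both or none of its sides in the region.\<close>

lemma boundary_edge_at:
  assumes "x \<in> D" "medge \<alpha> x \<in> medge \<alpha> ` set ds" "lab x = lab (c (Suc j))"
  shows "x = c (Suc j) \<or> x = \<alpha> (c j)"
proof -
  obtain i where "x = c i \<or> x = \<alpha> (c i)" using boundary_edge[OF assms(1,2)] by blast
  then show ?thesis
  proof
    assume "x = c i"
    then show ?thesis using lab_c_eq[of i "Suc j"] assms(3) c_mod by blast
  next
    assume x: "x = \<alpha> (c i)"
    then have "lab (c (Suc i)) = lab (c (Suc j))" using assms(3) lab_alpha_c by simp
    then show ?thesis using lab_c_eq mod_Suc_cancel c_mod x by metis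
  qed
qed

lemma third_edge_left:
  assumes "left j"
  shows "medge \<alpha> (\<sigma> (\<sigma> (\<alpha> (c j)))) \<notin> medge \<alpha> ` set ds"
proof
  let ?y = "\<alpha> (c j)"
  have y: "?y \<in> D" using c_in by simp
  assume "medge \<alpha> (\<sigma> (\<sigma> ?y)) \<in> medge \<alpha> ` set ds"
  then have "\<sigma> (\<sigma> ?y) = c (Suc j) \<or> \<sigma> (\<sigma> ?y) = ?y"
    using y by (intro boundary_edge_at) (auto simp: lab_alpha_c)
  then show False using y assms unfolding left_def by auto
qed

lemma third_edge_right:
  assumes "\<not> left j"
  shows "medge \<alpha> (\<sigma> (\<alpha> (c j))) \<notin> medge \<alpha> ` set ds"
proof
  let ?y = "\<alpha> (c j)"
  have y: "?y \<in> D" using c_in by simp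
  assume "medge \<alpha> (\<sigma> ?y) \<in> medge \<alpha> ` set ds"
  then have "\<sigma> ?y = c (Suc j) \<or> \<sigma> ?y = ?y"
    using y by (intro boundary_edge_at) (auto simp: lab_alpha_c)
  then show False using y turn[OF assms] by auto
qed

text \<open>The region stays on the left: a left turn continues the same face, and at a right turn
  the edge in between is not on the cycle, so the corners on both of its sides lie in
  \<open>X\<close>.\<close>

lemma c_in_X: "c j \<in> X"
  and alpha_c_notin_X: "\<alpha> (c j) \<notin> X"
proof -
  show "c j \<in> X"
  proof (induction j)
    case 0 then show ?case using start by (simp add: c_def)
  next
    case (Suc j)
    then have y: "\<sigma> (\<alpha> (c j)) \<in> X" by (rule X_closed)
    show ?case
    proof (cases "left j")
      case True then show ?thesis using y unfolding left_def by simp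
    next
      case False
      then show ?thesis
        using interior_edge(2)[OF X_in[OF y] third_edge_right[OF False]] y turn by simp
    qed
  qed
  moreover have "medge \<alpha> (c j) \<in> medge \<alpha> ` set ds" using c_in_set by blast
  ultimately show "\<alpha> (c j) \<notin> X" using boundary[OF c_in] by blast
qed

lemma corners_at:
  "{x \<in> X. lab x = lab (c (Suc j))} =
    (if left j then {\<sigma> (\<alpha> (c j))} else {\<sigma> (\<alpha> (c j)), \<sigma> (\<sigma> (\<alpha> (c j)))})"
proof -
  let ?y = "\<alpha> (c j)"
  have y: "?y \<in> D" "lab ?y = lab (c (Suc j))" using c_in lab_alpha_c by auto
  have "lab x = lab (c (Suc j)) \<longleftrightarrow> x \<in> {?y, \<sigma> ?y, \<sigma> (\<sigma> ?y)}" if "x \<in> X" for x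
    using lab_eq_iff[OF y(1) X_in[OF that]] y(2) by metis
  then have "{x \<in> X. lab x = lab (c (Suc j))} = X \<inter> {?y, \<sigma> ?y, \<sigma> (\<sigma> ?y)}" by blast
  moreover have "\<sigma> ?y \<in> X" using X_closed[OF c_in_X] .
  moreover have "\<sigma> (\<sigma> ?y) \<in> X \<longleftrightarrow> \<not> left j"
  proof (cases "left j")
    case True
    then show ?thesis using interior_edge(2)[OF _ third_edge_left[OF True]] y alpha_c_notin_X by simp
  next
    case False
    then show ?thesis using turn c_in_X by metis
  qed
  ultimately show ?thesis using alpha_c_notin_X by auto
qed

section \<open>Counting the corners of the region\<close>

definition Xint :: "'d set" where "Xint = {x \<in> X. lab x \<notin> lab ` set ds}"
definition Xbd :: "'d set" where "Xbd = {x \<in> X. lab x \<in> lab ` set ds}"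

lemma X_split: "X = Xint \<union> Xbd" "Xint \<inter> Xbd = {}"
  unfolding Xint_def Xbd_def by auto

lemma lab_set_ds: "lab ` set ds = (\<lambda>j. lab (c (Suc j))) ` {..<length ds}"
proof
  show "lab ` set ds \<subseteq> (\<lambda>j. lab (c (Suc j))) ` {..<length ds}"
  proof
    fix v assume "v \<in> lab ` set ds"
    then obtain x where x: "x \<in> set ds" "v = lab x" by blast
    then obtain j where j: "v = lab (c j)" using in_set_c[of x] by blast
    \<comment> \<open>The vertex of \<open>c j\<close> is the end of the preceding dart. Adding the
      length avoids a truncated subtraction at j = 0.\<close>
    have "Suc ((j + length ds - 1) mod length ds) mod length ds = (j + length ds) mod length ds"
      unfolding mod_Suc_eq using length_ge by (intro arg_cong[of _ _ "\<lambda>j. j mod length ds"]) linarith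
    then have "c (Suc ((j + length ds - 1) mod length ds)) = c j" by (intro c_mod) simp
    then show "v \<in> (\<lambda>j. lab (c (Suc j))) ` {..<length ds}"
      using j length_ge
      by (intro image_eqI[of _ _ "(j + length ds - 1) mod length ds"]) (auto intro!: mod_less_divisor)
  qed
  show "(\<lambda>j. lab (c (Suc j))) ` {..<length ds} \<subseteq> lab ` set ds" using c_in_set by auto
qed

lemma Xbd_eq: "Xbd = (\<Union>j<length ds. {x \<in> X. lab x = lab (c (Suc j))})"
  unfolding Xbd_def lab_set_ds by auto

lemma card_Xbd:
  "card {x \<in> Xbd. P x} =
    (\<Sum>j<length ds. of_bool (P (\<sigma> (\<alpha> (c j)))) + of_bool (\<not> left j \<and> P (\<sigma> (\<sigma> (\<alpha> (c j))))))"
proof -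
  let ?V = "\<lambda>j. {x \<in> X. lab x = lab (c (Suc j)) \<and> P x}"
  have "{x \<in> Xbd. P x} = (\<Union>j<length ds. ?V j)" unfolding Xbd_eq by auto
  moreover have "card (\<Union>j<length ds. ?V j) = (\<Sum>j<length ds. card (?V j))"
  proof (rule card_UN_disjoint)
    show "\<forall>i\<in>{..<length ds}. \<forall>j\<in>{..<length ds}. i \<noteq> j \<longrightarrow> ?V i \<inter> ?V j = {}"
    proof (intro ballI impI)
      fix i j assume "i \<in> {..<length ds}" "j \<in> {..<length ds}" "i \<noteq> j"
      then have "i mod length ds \<noteq> j mod length ds" by simp
      then have "lab (c (Suc i)) \<noteq> lab (c (Suc j))" using lab_c_eq mod_Suc_cancel by blast
      then show "?V i \<inter> ?V j = {}" by auto
    qed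
  qed (use finite_X in auto)
  moreover have "card (?V j) = of_bool (P (\<sigma> (\<alpha> (c j)))) + of_bool (\<not> left j \<and> P (\<sigma> (\<sigma> (\<alpha> (c j)))))" for j
  proof -
    have y: "\<alpha> (c j) \<in> D" using c_in by simp
    have "?V j = {x \<in> {x \<in> X. lab x = lab (c (Suc j))}. P x}" by auto
    also have "\<dots> = (if P (\<sigma> (\<alpha> (c j))) then {\<sigma> (\<alpha> (c j))} else {}) \<union>
        (if \<not> left j \<and> P (\<sigma> (\<sigma> (\<alpha> (c j)))) then {\<sigma> (\<sigma> (\<alpha> (c j)))} else {})"
      unfolding corners_at by auto
    finally have V: "?V j = (if P (\<sigma> (\<alpha> (c j))) then {\<sigma> (\<alpha> (c j))} else {}) \<union>
        (if \<not> left j \<and> P (\<sigma> (\<sigma> (\<alpha> (c j)))) then {\<sigma> (\<sigma> (\<alpha> (c j)))} else {})" .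
    show ?thesis unfolding V using y by (simp add: card_insert_if)
  qed
  ultimately show ?thesis by simp
qed

text \<open>No edge at a vertex off the cycle is a boundary edge, so the region contains all three
  corners there.\<close>

lemma interior_step:
  assumes "x \<in> Xint"
  shows "\<alpha> x \<in> X" "\<sigma> x \<in> Xint"
proof -
  have x: "x \<in> D" "x \<in> X" "lab x \<notin> lab ` set ds" using assms X_in unfolding Xint_def by auto
  have e: "medge \<alpha> x \<notin> medge \<alpha> ` set ds"
  proof
    assume "medge \<alpha> x \<in> medge \<alpha> ` set ds"
    then obtain i where "x = c i \<or> x = \<alpha> (c i)" using boundary_edge[OF x(1)] by blast
    then have "lab x = lab (c i) \<or> lab x = lab (c (Suc i))" using lab_alpha_c by auto
    then show False using x(3) c_in_set by auto
  qed
  show "\<alpha> x \<in> X" "\<sigma> x \<in> Xint" using interior_edge[OF x(1) e] x unfolding Xint_def by auto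
qed

definition inner :: nat where "inner = card (orbit \<sigma> ` Xint)"

text \<open>A vertex has exactly one corner of each colour, so interior vertices contribute equally
  to the three colours.\<close>

lemma card_Xint_colour: "card {x \<in> Xint. colour x = k} = inner"
proof -
  have D: "x \<in> Xint \<Longrightarrow> x \<in> D" for x using X_in unfolding Xint_def by auto
  have "inj_on (orbit \<sigma>) {x \<in> Xint. colour x = k}"
  proof (rule inj_onI)
    fix x y assume xy: "x \<in> {x \<in> Xint. colour x = k}" "y \<in> {x \<in> Xint. colour x = k}" "orbit \<sigma> x = orbit \<sigma> y"
    then have "y \<in> {x, \<sigma> x, \<sigma> (\<sigma> x)}" using orbit_self[of y \<sigma>] sigma_orbit(2)[of x] D by auto
    then show "x = y" using xy D colour_distinct[of x] by auto
  qed
  moreover have "orbit \<sigma> ` {x \<in> Xint. colour x = k} = orbit \<sigma> ` Xint"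
  proof
    show "orbit \<sigma> ` Xint \<subseteq> orbit \<sigma> ` {x \<in> Xint. colour x = k}"
    proof
      fix O' assume "O' \<in> orbit \<sigma> ` Xint"
      then obtain x where x: "x \<in> Xint" "O' = orbit \<sigma> x" by blast
      have "x \<in> D" using D x by blast
      then obtain y where y: "y \<in> {x, \<sigma> x, \<sigma> (\<sigma> x)}" "colour y = k"
        using col_cases3[of "colour x" "colour (\<sigma> x)" "colour (\<sigma> (\<sigma> x))" k] colour_distinct[of x] by auto
      then have "y \<in> Xint" using interior_step(2) x(1) by auto
      moreover have "orbit \<sigma> y = O'"
        using orbit_eq[OF finite_darts bij_sigma \<open>x \<in> D\<close>, of y] sigma_orbit(2)[OF \<open>x \<in> D\<close>] y(1) x(2) by simp
      ultimately show "O' \<in> orbit \<sigma> ` {x \<in> Xint. colour x = k}" using y(2) by blast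
    qed
  qed auto
  ultimately show ?thesis unfolding inner_def using card_image[of "orbit \<sigma>" "{x \<in> Xint. colour x = k}"] by simp
qed

definition word :: "bool list" where "word = map left [0..<length ds]"

text \<open>If the dart \<open>c m\<close> is in state (l, r, t), the darts
  \<open>\<alpha> (c m)\<close>, \<open>\<sigma> (\<alpha> (c m))\<close> and
  \<open>\<sigma> (\<sigma> (\<alpha> (c m)))\<close> at its end have colours r, l, t. The next
  state is read off from these. The start index m is general for the sake of the induction.\<close>

lemma corner_count_sum:
  "sum_list (map (\<lambda>j. of_bool (colour (c j) = k) + of_bool (\<not> left j \<and> colour (\<sigma> (\<sigma> (c j))) = k)) [m..<m + n]) =
    corner_count k (colour (c m)) (colour (\<sigma> (c m))) (colour (\<sigma> (\<sigma> (c m)))) (map left [m..<m + n])"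
proof (induction n arbitrary: m)
  case (Suc n)
  have y: "c m \<in> D" "\<alpha> (c m) \<in> D" using c_in by auto
  have l: "[m..<m + Suc n] = m # [Suc m..<Suc m + n]" by (simp add: upt_conv_Cons del: upt_Suc)
  obtain L where L: "map left [Suc m..<Suc m + n] = L" by blast
  show ?case
    unfolding l list.map sum_list.Cons Suc[of "Suc m"] L
  proof (cases "left m")
    case True
    then have "c (Suc m) = \<sigma> (\<alpha> (c m))" unfolding left_def .
    then show "of_bool (colour (c m) = k) + of_bool (\<not> left m \<and> colour (\<sigma> (\<sigma> (c m))) = k) +
      corner_count k (colour (c (Suc m))) (colour (\<sigma> (c (Suc m)))) (colour (\<sigma> (\<sigma> (c (Suc m))))) L =
      corner_count k (colour (c m)) (colour (\<sigma> (c m))) (colour (\<sigma> (\<sigma> (c m)))) (left m # L)"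
      using True y by simp
  next
    case False
    then show "of_bool (colour (c m) = k) + of_bool (\<not> left m \<and> colour (\<sigma> (\<sigma> (c m))) = k) +
      corner_count k (colour (c (Suc m))) (colour (\<sigma> (c (Suc m)))) (colour (\<sigma> (\<sigma> (c (Suc m))))) L =
      corner_count k (colour (c m)) (colour (\<sigma> (c m))) (colour (\<sigma> (\<sigma> (c m)))) (left m # L)"
      using turn[OF False] y by simp
  qed
qed simp

lemma card_X_colour:
  "card {x \<in> X. colour x = k} =
    inner + corner_count k (colour (ds ! 0)) (colour (\<sigma> (ds ! 0))) (colour (\<sigma> (\<sigma> (ds ! 0)))) word"
proof -
  have "{x \<in> X. colour x = k} = {x \<in> Xint. colour x = k} \<union> {x \<in> Xbd. colour x = k}"
    "{x \<in> Xint. colour x = k} \<inter> {x \<in> Xbd. colour x = k} = {}" using X_split by auto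
  moreover have "finite {x \<in> Xint. colour x = k}" "finite {x \<in> Xbd. colour x = k}"
    using finite_X unfolding Xint_def Xbd_def by auto
  ultimately have "card {x \<in> X. colour x = k} = inner + card {x \<in> Xbd. colour x = k}"
    by (simp add: card_Un_disjoint card_Xint_colour)
  also have "card {x \<in> Xbd. colour x = k} =
      sum_list (map (\<lambda>j. of_bool (colour (c j) = k) + of_bool (\<not> left j \<and> colour (\<sigma> (\<sigma> (c j))) = k)) [0..<0 + length ds])"
    unfolding card_Xbd using c_in by (simp add: interv_sum_list_conv_sum_set_nat atLeast0LessThan)
  also have "\<dots> = corner_count k (colour (ds ! 0)) (colour (\<sigma> (ds ! 0))) (colour (\<sigma> (\<sigma> (ds ! 0)))) word"
    unfolding corner_count_sum word_def by (simp add: c_def)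
  finally show ?thesis .
qed

lemma card_X: "card X = 3 * inner + length ds + length (filter Not word)"
proof -
  have D: "finite Xint" "finite Xbd" using finite_X X_split(1) by (metis finite_Un)+
  have "Xint = {x \<in> Xint. colour x = Ca} \<union> {x \<in> Xint. colour x = Cb} \<union> {x \<in> Xint. colour x = Cc}"
    using col.exhaust by blast
  moreover have "card ({x \<in> Xint. colour x = Ca} \<union> {x \<in> Xint. colour x = Cb} \<union> {x \<in> Xint. colour x = Cc})
      = inner + inner + inner"
    using D(1) by (subst card_Un_disjoint; (subst card_Un_disjoint)?) (auto simp: card_Xint_colour)
  ultimately have 1: "card Xint = 3 * inner" by simp
  have "card Xbd = (\<Sum>j<length ds. 1 + of_bool (\<not> left j))" using card_Xbd[of "\<lambda>_. True"] by simp
  also have "\<dots> = length ds + (\<Sum>j<length ds. of_bool (\<not> left j))" unfolding sum.distrib by simp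
  also have "(\<Sum>j<length ds. of_bool (\<not> left j)) = card ({..<length ds} \<inter> {j. \<not> left j})"
    by simp
  also have "\<dots> = length (filter Not word)"
  proof -
    have "length (filter Not word) = length (filter (\<lambda>j. \<not> left j) [0..<length ds])"
      unfolding word_def by (simp add: filter_map comp_def)
    also have "\<dots> = card (set (filter (\<lambda>j. \<not> left j) [0..<length ds]))"
      by (intro distinct_card[symmetric] distinct_filter distinct_upt)
    also have "set (filter (\<lambda>j. \<not> left j) [0..<length ds]) = {..<length ds} \<inter> {j. \<not> left j}" by auto
    finally show ?thesis by simp
  qed
  finally have "card Xbd = length ds + length (filter Not word)" .
  moreover have "card X = card Xint + card Xbd" using X_split D by (metis card_Un_disjoint)
  ultimately show ?thesis using 1 by simp
qed

lemma card_X_eq_faces: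
  assumes W: "\<And>x. x \<in> D \<Longrightarrow> weight \<alpha> \<sigma> x = W (colour x)"
  shows "card {x \<in> X. colour x = k} = W k * card (orbits \<phi> {x \<in> X. colour x = k})"
proof -
  let ?A = "{x \<in> X. colour x = k}"
  have U: "\<Union>(orbits \<phi> ?A) = ?A"
  proof
    show "\<Union>(orbits \<phi> ?A) \<subseteq> ?A"
      unfolding orbits_def using orbit_in_domain[OF bij_phi_X] colour_orbit X_in by auto
    show "?A \<subseteq> \<Union>(orbits \<phi> ?A)"
    proof
      fix x assume "x \<in> ?A"
      then have "orbit \<phi> x \<in> orbits \<phi> ?A" unfolding orbits_def by (rule imageI)
      then show "x \<in> \<Union>(orbits \<phi> ?A)" using orbit_self[of x \<phi>] by (rule UnionI)
    qed
  qed
  have "W k * card (orbits \<phi> ?A) = card (\<Union>(orbits \<phi> ?A))"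
  proof (rule card_partition)
    show "finite (orbits \<phi> ?A)" unfolding orbits_def using finite_X by simp
    show "finite (\<Union>(orbits \<phi> ?A))" unfolding U using finite_X by simp
    show "card O' = W k" if "O' \<in> orbits \<phi> ?A" for O'
      using that W weight_eq_card X_in unfolding orbits_def by auto
    show "O1 \<inter> O2 = {}" if "O1 \<in> orbits \<phi> ?A" "O2 \<in> orbits \<phi> ?A" "O1 \<noteq> O2" for O1 O2
      using that orbit_disjoint[OF finite_X bij_phi_X] unfolding orbits_def by blast
  qed
  then show ?thesis unfolding U by simp
qed

lemma card_orbits_X:
  "card (orbits \<phi> X) = card (orbits \<phi> {x \<in> X. colour x = Ca}) + card (orbits \<phi> {x \<in> X. colour x = Cb})
    + card (orbits \<phi> {x \<in> X. colour x = Cc})"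
proof -
  let ?O = "\<lambda>k. orbits \<phi> {x \<in> X. colour x = k}"
  have "X = {x \<in> X. colour x = Ca} \<union> {x \<in> X. colour x = Cb} \<union> {x \<in> X. colour x = Cc}"
    using col.exhaust by blast
  then have "orbits \<phi> X = ?O Ca \<union> ?O Cb \<union> ?O Cc" unfolding orbits_def by (metis image_Un)
  moreover have disj: "?O k \<inter> ?O l = {}" if "k \<noteq> l" for k l
  proof (rule ccontr)
    assume "?O k \<inter> ?O l \<noteq> {}"
    then obtain x y where xy: "x \<in> X" "y \<in> X" "colour x = k" "colour y = l" "orbit \<phi> x = orbit \<phi> y"
      unfolding orbits_def by auto
    then have "y \<in> orbit \<phi> x" using orbit_self[of y \<phi>] by simp
    then show False using colour_orbit[OF X_in[OF xy(1)]] xy that by simp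
  qed
  moreover have "finite (?O k)" for k unfolding orbits_def using finite_X by simp
  ultimately show ?thesis by (simp add: card_Un_disjoint Int_Un_distrib2)
qed

lemma boundary_darts: "{x \<in> X. \<alpha> x \<notin> X} = c ` {..<length ds}"
proof
  show "c ` {..<length ds} \<subseteq> {x \<in> X. \<alpha> x \<notin> X}" using c_in_X alpha_c_notin_X by auto
  show "{x \<in> X. \<alpha> x \<notin> X} \<subseteq> c ` {..<length ds}"
  proof
    fix x assume x: "x \<in> {x \<in> X. \<alpha> x \<notin> X}"
    then have "medge \<alpha> x \<in> medge \<alpha> ` set ds" using boundary X_in by blast
    moreover have "x \<in> D" using X_in x by simp
    ultimately obtain i where "x = c i \<or> x = \<alpha> (c i)" using boundary_edge by metis
    then have "x = c i" using x alpha_c_notin_X by auto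
    then have "x = c (i mod length ds)" by (simp add: c_def)
    then show "x \<in> c ` {..<length ds}" using length_ge
      by (intro image_eqI[of _ _ "i mod length ds"]) (auto intro!: mod_less_divisor)
  qed
qed

lemma card_boundary_darts: "card {x \<in> X. \<alpha> x \<notin> X} = length ds"
proof -
  have "inj_on c {..<length ds}"
    using lab_c_eq by (intro inj_onI) (metis lessThan_iff mod_less)
  then show ?thesis unfolding boundary_darts using card_image by fastforce
qed

text \<open>Composing the face permutation of the region with the involution of its interior edges
turns around each interior vertex and once around the whole boundary.\<close>
lemma region_parity:
  obtains m where "2 * m = 3 * inner + length (filter Not word)"
    "even (card (orbits \<phi> X) + Suc inner + m)"
proof -
  define I where "I = {x \<in> X. \<alpha> x \<in> X}"
  define \<psi> where "\<psi> = (\<lambda>x. if x \<in> I then \<phi> (\<alpha> x) else \<phi> x)"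
  have "\<exists>m. card I = 2 * m \<and> bij_betw \<psi> X X \<and> even (card (orbits \<phi> X) + card (orbits \<psi> X) + m)"
    unfolding \<psi>_def
    by (rule card_orbits_involution_parity[OF finite_X bij_phi_X]) (auto simp: I_def X_in)
  then obtain m where m: "card I = 2 * m" "bij_betw \<psi> X X"
    "even (card (orbits \<phi> X) + card (orbits \<psi> X) + m)" by blast
  \<comment> \<open>The boundary darts are those of the cycle. Removing them from
    \<open>card X\<close> leaves two darts for each of the m interior edges.\<close>
  have "X = I \<union> {x \<in> X. \<alpha> x \<notin> X}" "I \<inter> {x \<in> X. \<alpha> x \<notin> X} = {}" unfolding I_def by auto
  then have "card X = card I + length ds"
    using card_Un_disjoint[of I "{x \<in> X. \<alpha> x \<notin> X}"] finite_X card_boundary_darts by (metis finite_Un)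
  then have "2 * m = 3 * inner + length (filter Not word)" using m(1) card_X by simp
  moreover have "card (orbits \<psi> X) = Suc inner"
  proof -
    have psi_I: "x \<in> I \<Longrightarrow> \<psi> x = \<sigma> x" for x unfolding \<psi>_def using X_in by (simp add: I_def)
    have psi_c: "\<psi> (c j) = \<sigma> (\<alpha> (c j))" for j unfolding \<psi>_def I_def using alpha_c_notin_X by simp
    have psi_right: "\<psi> (\<sigma> (\<alpha> (c j))) = c (Suc j)" if "\<not> left j" for j
    proof -
      have z: "\<sigma> (\<alpha> (c j)) \<in> X" using X_closed[OF c_in_X] .
      then have "\<sigma> (\<alpha> (c j)) \<in> I"
        using interior_edge(1)[OF X_in third_edge_right[OF that]] unfolding I_def by simp
      then show ?thesis using psi_I turn[OF that] by simp
    qed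
    have int: "orbit \<psi> x = orbit \<sigma> x" if "x \<in> Xint" for x
    proof (rule orbit_cong_on[symmetric])
      show "x \<in> Xint" by (rule that)
      fix y assume y: "y \<in> Xint"
      show "\<sigma> y \<in> Xint" using interior_step(2)[OF y] .
      have "y \<in> I" using interior_step(1)[OF y] y unfolding I_def Xint_def by simp
      then show "\<sigma> y = \<psi> y" using psi_I by simp
    qed
    have Xbd_c: "x \<in> Xbd \<longleftrightarrow> (\<exists>j. x = \<sigma> (\<alpha> (c j)) \<or> x = c (Suc j))" for x
    proof
      assume "x \<in> Xbd"
      then obtain j where "x \<in> {x \<in> X. lab x = lab (c (Suc j))}" unfolding Xbd_eq by blast
      then have "x = \<sigma> (\<alpha> (c j)) \<or> x = \<sigma> (\<sigma> (\<alpha> (c j))) \<and> \<not> left j"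
        unfolding corners_at by (auto split: if_splits)
      then show "\<exists>j. x = \<sigma> (\<alpha> (c j)) \<or> x = c (Suc j)" using turn[of j] by metis
    next
      assume "\<exists>j. x = \<sigma> (\<alpha> (c j)) \<or> x = c (Suc j)"
      then obtain j where "x = \<sigma> (\<alpha> (c j)) \<or> x = c (Suc j)" by blast
      moreover have "\<sigma> (\<alpha> (c j)) \<in> X" "c (Suc j) \<in> X" using X_closed[OF c_in_X] c_in_X by auto
      moreover have "lab (\<sigma> (\<alpha> (c j))) = lab (c (Suc j))" using c_in lab_alpha_c by simp
      ultimately show "x \<in> Xbd" unfolding Xbd_def using c_in_set by auto
    qed
    \<comment> \<open>From \<open>c j\<close> the map \<open>\<psi>\<close> goes to the first corner
      at the next vertex. This is already \<open>c (Suc j)\<close> at a left turn, and a right turn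
      takes one more step, so a single cycle runs around the boundary.\<close>
    have c0: "c j \<in> orbit \<psi> (c 0)" for j
    proof (induction j)
      case (Suc j)
      then have s: "\<sigma> (\<alpha> (c j)) \<in> orbit \<psi> (c 0)" using orbit_step[OF Suc] psi_c by simp
      show ?case
      proof (cases "left j")
        case True then show ?thesis using s unfolding left_def by simp
      next
        case False then show ?thesis using orbit_step[OF s] psi_right by simp
      qed
    qed (rule orbit_self)
    have c0bd: "c 0 \<in> Xbd" using c_in_X c_in_set unfolding Xbd_def by auto
    have bd0: "orbit \<psi> (c 0) = Xbd"
    proof
      show "orbit \<psi> (c 0) \<subseteq> Xbd"
      proof (rule orbit_subset[OF c0bd])
        fix y assume "y \<in> Xbd"
        then obtain j where "y = \<sigma> (\<alpha> (c j)) \<or> y = c (Suc j)" using Xbd_c by blast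
        then have "(\<exists>i. y = c i) \<or> y = \<sigma> (\<alpha> (c j)) \<and> \<not> left j" unfolding left_def by metis
        then show "\<psi> y \<in> Xbd" using psi_c psi_right Xbd_c by metis
      qed
      show "Xbd \<subseteq> orbit \<psi> (c 0)"
      proof
        fix x assume "x \<in> Xbd"
        then obtain j where "x = \<sigma> (\<alpha> (c j)) \<or> x = c (Suc j)" using Xbd_c by blast
        then show "x \<in> orbit \<psi> (c 0)" using c0 orbit_step[OF c0[of j]] psi_c by auto
      qed
    qed
    have "orbit \<psi> ` Xbd = {Xbd}"
    proof -
      have "orbit \<psi> x = Xbd" if "x \<in> Xbd" for x
        using orbit_eq[OF finite_X m(2) c_in_X, of x 0] bd0 that by simp
      then show ?thesis using c0bd by auto
    qed
    moreover have "orbit \<psi> ` Xint = orbit \<sigma> ` Xint" using int by auto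
    ultimately have "orbits \<psi> X = insert Xbd (orbit \<sigma> ` Xint)"
      unfolding orbits_def by (subst X_split(1)) (simp only: image_Un, simp)
    moreover have "Xbd \<notin> orbit \<sigma> ` Xint"
    proof
      assume "Xbd \<in> orbit \<sigma> ` Xint"
      then obtain x where "x \<in> Xint" "Xbd = orbit \<sigma> x" by blast
      then show False using orbit_self[of x \<sigma>] X_split(2) by blast
    qed
    moreover have "finite (orbit \<sigma> ` Xint)" using finite_X unfolding Xint_def by simp
    ultimately show ?thesis unfolding inner_def by simp
  qed
  ultimately show ?thesis using that m(3) by simp
qed

end

context coloured_map begin

text \<open>Here i, m and \<open>F k\<close> count the interior vertices, the interior edges and the
  faces of colour k in the region. The cycle has as many vertices as edges, so these cancel in the
  Euler characteristic, and the evenness condition says that the Euler characteristic is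
  odd.\<close>

lemma contractible_cycle_counts:
  assumes cyc: "is_cycle D \<alpha> lab ds" and con: "contractible D \<alpha> \<sigma> (medge \<alpha> ` set ds)"
    and W: "\<And>x. x \<in> D \<Longrightarrow> weight \<alpha> \<sigma> x = W (colour x)"
  shows "\<exists>w i m F. length w = length ds \<and> 2 * m = 3 * i + length (filter Not w) \<and>
    even (F Ca + F Cb + F Cc + Suc i + m) \<and>
    (\<forall>k. i + corner_count k (colour (ds ! 0)) (colour (\<sigma> (ds ! 0))) (colour (\<sigma> (\<sigma> (ds ! 0)))) w = W k * F k)"
proof -
  obtain X where X: "X \<subseteq> D" "\<forall>x\<in>X. \<sigma> (\<alpha> x) \<in> X"
    "\<forall>d\<in>D. (medge \<alpha> d \<in> medge \<alpha> ` set ds) \<longleftrightarrow> ((d \<in> X) \<noteq> (\<alpha> d \<in> X))"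
    using con unfolding contractible_def by blast
  have d0: "ds ! 0 \<in> D" using cyc unfolding is_cycle_def by (metis One_nat_def Suc_le_eq nth_mem one_add_one plus_1_eq_Suc subsetD Suc_lessD)
  obtain Y where "bounded_region D \<alpha> \<sigma> lab fc ds Y"
  proof (cases "ds ! 0 \<in> X")
    case True
    then have "bounded_region D \<alpha> \<sigma> lab fc ds X" using cyc X by unfold_locales auto
    then show ?thesis by (rule that)
  next
    case False
    \<comment> \<open>The complement has the same boundary modulo 2. It is closed under
      \<open>\<phi>\<close> because \<open>\<phi>\<close> permutes the finite set X.\<close>
    have inj: "inj_on \<phi> X" using bij_phi X(1) inj_on_subset unfolding bij_betw_def by blast
    have "\<phi> ` X = X"
      by (rule endo_inj_surj[OF _ _ inj]) (use X finite_darts finite_subset in auto)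
    then have closed: "\<sigma> (\<alpha> x) \<in> D - X" if x: "x \<in> D - X" for x
    proof -
      have "\<sigma> (\<alpha> x) \<notin> X"
      proof
        assume "\<sigma> (\<alpha> x) \<in> X"
        then obtain y where "y \<in> X" "\<sigma> (\<alpha> x) = \<sigma> (\<alpha> y)" using \<open>\<phi> ` X = X\<close> by (metis comp_apply imageE)
        then show False using x X(1) sigma_eq_iff[of "\<alpha> x" "\<alpha> y"] alpha_eq_iff[of x y] by auto
      qed
      then show ?thesis using x by simp
    qed
    have "bounded_region D \<alpha> \<sigma> lab fc ds (D - X)"
      using cyc X(3) False d0 closed by unfold_locales auto
    then show ?thesis by (rule that)
  qed
  then interpret bounded_region D \<alpha> \<sigma> lab fc ds Y .
  obtain m where m: "2 * m = 3 * inner + length (filter Not word)"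
    "even (card (orbits \<phi> Y) + Suc inner + m)" by (rule region_parity)
  show ?thesis
    using m card_X_eq_faces[OF W] card_X_colour card_orbits_X
    by (intro exI[of _ word] exI[of _ inner] exI[of _ m] exI[of _ "\<lambda>k. card (orbits \<phi> {x \<in> Y. colour x = k})"])
      (simp add: word_def)
qed

end

section \<open>Short contractible cycles\<close>

lemma length_4_obtain:
  assumes "length w = 4" obtains a b c d where "w = [a, b, c, d]"
  using assms by (auto simp: length_Suc_conv numeral_eq_Suc)

lemma length_6_obtain:
  assumes "length w = 6" obtains a b c d e f where "w = [a, b, c, d, e, f]"
  using assms by (auto simp: length_Suc_conv numeral_eq_Suc)

text \<open>The numbers in the names of this family are the face weights for the colours l, r, t.
  For each of the sixteen words of length 4 the three congruences have no common solution i.\<close>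

lemma no_word_666:
  assumes "l \<noteq> r" "r \<noteq> t" "l \<noteq> t" and "length w = 4"
    and "i + corner_count l l r t w = 6 * a" "i + corner_count r l r t w = 6 * b"
      "i + corner_count t l r t w = 6 * c"
  shows False
proof -
  obtain t1 t2 t3 t4 where w: "w = [t1, t2, t3, t4]" using length_4_obtain[OF assms(4)] .
  show False
    using assms(1-3,5-) unfolding w
    by (cases t1; cases t2; cases t3; cases t4; simp; presburger)
qed

lemma no_word_884_4:
  assumes "l \<noteq> r" "r \<noteq> t" "l \<noteq> t" and "length w = 4"
    and "i + corner_count l l r t w = 8 * a" "i + corner_count r l r t w = 8 * b"
      "i + corner_count t l r t w = 4 * c"
  shows False
proof -
  obtain t1 t2 t3 t4 where w: "w = [t1, t2, t3, t4]" using length_4_obtain[OF assms(4)] .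
  show False
    using assms(1-3,5-) unfolding w
    by (cases t1; cases t2; cases t3; cases t4; simp; presburger)
qed

lemma no_word_6_12_4:
  assumes "l \<noteq> r" "r \<noteq> t" "l \<noteq> t" and "length w = 4"
    and "i + corner_count l l r t w = 6 * a" "i + corner_count r l r t w = 12 * b"
      "i + corner_count t l r t w = 4 * c"
  shows False
proof -
  obtain t1 t2 t3 t4 where w: "w = [t1, t2, t3, t4]" using length_4_obtain[OF assms(4)] .
  show False
    using assms(1-3,5-) unfolding w
    by (cases t1; cases t2; cases t3; cases t4; simp; presburger)
qed

lemma no_word_12_6_4:
  assumes "l \<noteq> r" "r \<noteq> t" "l \<noteq> t" and "length w = 4"
    and "i + corner_count l l r t w = 12 * a" "i + corner_count r l r t w = 6 * b"
      "i + corner_count t l r t w = 4 * c"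
  shows False
proof -
  obtain t1 t2 t3 t4 where w: "w = [t1, t2, t3, t4]" using length_4_obtain[OF assms(4)] .
  show False
    using assms(1-3,5-) unfolding w
    by (cases t1; cases t2; cases t3; cases t4; simp; presburger)
qed

text \<open>The congruences leave four words, such as strictly alternating turns, which the parity excludes.\<close>
lemma no_word_884_6:
  assumes "l \<noteq> r" "r \<noteq> t" "l \<noteq> t" and "length w = 6"
    and "i + corner_count l l r t w = 8 * a" "i + corner_count r l r t w = 8 * b"
      "i + corner_count t l r t w = 4 * c"
    and "2 * m = 3 * i + length (filter Not w)" "even (a + b + c + Suc i + m)"
  shows False
proof -
  obtain t1 t2 t3 t4 t5 t6 where w: "w = [t1, t2, t3, t4, t5, t6]" using length_6_obtain[OF assms(4)] .
  \<comment> \<open>Differences eliminate i and leave conditions on the word alone, modulo 8 for the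
    two octagon colours and modulo 4 against the squares.\<close>
  have m: "corner_count l l r t w mod 8 = corner_count r l r t w mod 8"
    "corner_count l l r t w mod 4 = corner_count t l r t w mod 4"
  proof -
    let ?s = "\<lambda>k. corner_count k l r t w"
    have "?s l + 8 * b = ?s r + 8 * a" "?s l + 4 * c = ?s t + 4 * (2 * a)" using assms(5-7) by linarith+
    then show "?s l mod 8 = ?s r mod 8" "?s l mod 4 = ?s t mod 4" by (metis mod_mult_self2)+
  qed
  have "w \<in> {[True, False, True, True, False, True], [True, False, True, False, True, False],
      [False, True, False, True, False, True], [False, True, False, False, True, False]}"
    using assms(1-3) m unfolding w
    by (cases t1; cases t2; cases t3; cases t4; cases t5; cases t6; simp)
  \<comment> \<open>For a fixed word i is affine in a, and so are b, c and m. The sum required to be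
    even becomes \<open>24 * a\<close> minus 9, 5 or 1.\<close>
  then consider "w = [True, False, True, True, False, True]" | "w = [True, False, True, False, True, False]"
    | "w = [False, True, False, True, False, True]" | "w = [False, True, False, False, True, False]" by blast
  then have "a + b + c + Suc i + m + 9 = 24 * a \<or> a + b + c + Suc i + m + 5 = 24 * a
      \<or> a + b + c + Suc i + m + 1 = 24 * a"
    by cases (use assms(1-3,5-8) in simp)+
  then show False
    using assms(9) by (metis even_add even_mult_iff even_numeral odd_numeral odd_one)
qed

context coloured_map begin

text \<open>Both faces at the first edge outweigh the cycle. This leaves the weight pairs (6,6),
  (8,8), (6,12) and (12,6) for its two sides, and length 6 only for two octagons.\<close>

lemma no_short_contractible_cycle:
  assumes T: "of_type T D \<alpha> \<sigma>" and cyc: "is_cycle D \<alpha> lab ds" and con: "contractible D \<alpha> \<sigma> (medge \<alpha> ` set ds)"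
    and len: "length ds = 4 \<or> length ds = 6"
    and short: "length ds < weight \<alpha> \<sigma> (ds ! 0)" "length ds < weight \<alpha> \<sigma> (\<alpha> (ds ! 0))"
  shows False
proof -
  obtain W where W: "\<And>x. x \<in> D \<Longrightarrow> weight \<alpha> \<sigma> x = W (colour x)" using weight_by_colour[OF T] by metis
  let ?d = "ds ! 0"
  let ?l = "colour ?d" and ?r = "colour (\<sigma> ?d)" and ?t = "colour (\<sigma> (\<sigma> ?d))"
  have d: "?d \<in> D" using cyc len unfolding is_cycle_def by (auto intro!: subsetD[of "set ds" D] nth_mem)
  obtain w i m F where w: "length w = length ds" "2 * m = 3 * i + length (filter Not w)"
    "even (F Ca + F Cb + F Cc + Suc i + m)"
    and eq: "\<And>k. i + corner_count k ?l ?r ?t w = W k * F k"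
    using contractible_cycle_counts[OF cyc con W] by blast
  have dist: "?l \<noteq> ?r" "?r \<noteq> ?t" "?l \<noteq> ?t" using colour_distinct[OF d] by auto
  \<comment> \<open>The parity is stated for absolute colours, the word lemmas for colours relative
    to the first dart.\<close>
  have sum: "F Ca + F Cb + F Cc = F ?l + F ?r + F ?t"
    using dist by (cases ?l; cases ?r; cases ?t) auto
  have "sort [W ?l, W ?r, W ?t] = config_of T"
    using T d W unfolding of_type_def vertex_config_def by (metis sigma_in)
  then have "W ?l = 6 \<and> W ?r = 6 \<and> W ?t = 6 \<and> length ds = 4 \<or> W ?l = 8 \<and> W ?r = 8 \<and> W ?t = 4
      \<or> W ?l = 6 \<and> W ?r = 12 \<and> W ?t = 4 \<and> length ds = 4 \<or> W ?l = 12 \<and> W ?r = 6 \<and> W ?t = 4 \<and> length ds = 4"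
    using short len d W by (cases T) (auto split: if_splits)
  then show False
    using no_word_666[OF dist, of w i] no_word_884_4[OF dist, of w i] no_word_6_12_4[OF dist, of w i]
      no_word_12_6_4[OF dist, of w i] no_word_884_6[OF dist, of w i "F ?l" "F ?r" "F ?t" m]
      eq[of ?l] eq[of ?r] eq[of ?t] w len sum by metis
qed

end

section \<open>Competing lattices\<close>

lemma (in coloured_map) card_vertex_darts:
  assumes "x \<in> D"
  shows "card {y \<in> D. lab y = lab x} = 3"
proof -
  have "{y \<in> D. lab y = lab x} = {x, \<sigma> x, \<sigma> (\<sigma> x)}"
    using lab_eq_iff[OF assms] assms by (auto; metis)
  then show ?thesis using assms by simp
qed

locale competitor = coloured_map D \<alpha> \<sigma> lab fc + H: coloured_map DH \<alpha>H \<sigma>H labH fcH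
  for D :: "'d set" and \<alpha> \<sigma> :: "'d \<Rightarrow> 'd" and lab :: "'d \<Rightarrow> 'v" and fc :: "'d set set \<Rightarrow> col"
    and DH :: "'h set" and \<alpha>H \<sigma>H :: "'h \<Rightarrow> 'h" and labH :: "'h \<Rightarrow> 'v" and fcH :: "'h set set \<Rightarrow> col" +
  fixes d0 :: 'd
  assumes w3: "\<And>x. x \<in> D \<Longrightarrow> weight \<alpha> \<sigma> x \<ge> 3" and d0: "d0 \<in> D"
    and adm: "admissible_H D \<alpha> lab d0 DH \<alpha>H \<sigma>H labH"
begin

text \<open>The darts of H that run along the dart x of G. As G has no parallel edges, the two end
  vertices identify x.\<close>

definition over :: "'d \<Rightarrow> 'h set" where
  "over x = {h \<in> DH. labH h = lab x \<and> labH (\<alpha>H h) = lab (\<alpha> x)}"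

definition mult :: "'d \<Rightarrow> nat" where
  "mult x = card (over x)"

lemma finite_over: "finite (over x)"
  unfolding over_def using H.finite_darts by simp

lemma labs: "labH ` DH = lab ` D"
  using adm unfolding admissible_H_def by blast

lemma mult_alpha:
  assumes "x \<in> D"
  shows "mult (\<alpha> x) = mult x"
proof -
  have "over (\<alpha> x) = \<alpha>H ` over x"
  proof
    show "over (\<alpha> x) \<subseteq> \<alpha>H ` over x"
    proof
      fix h assume "h \<in> over (\<alpha> x)"
      then have "h \<in> DH" "\<alpha>H h \<in> over x" using assms unfolding over_def by auto
      then show "h \<in> \<alpha>H ` over x" by (intro image_eqI[of _ _ "\<alpha>H h"]) auto
    qed
    show "\<alpha>H ` over x \<subseteq> over (\<alpha> x)" using assms unfolding over_def by auto
  qed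
  moreover have "inj_on \<alpha>H (over x)"
    by (rule inj_onI) (auto simp: over_def H.alpha_eq_iff)
  ultimately show ?thesis unfolding mult_def using card_image by metis
qed

lemma over_exists:
  assumes "h \<in> DH" "x \<in> D" "labH h = lab x"
  obtains y where "y \<in> {x, \<sigma> x, \<sigma> (\<sigma> x)}" "h \<in> over y" "medge \<alpha> y \<noteq> medge \<alpha> d0"
proof -
  note result = that
  obtain z where z: "z \<in> D" "medge \<alpha> z \<noteq> medge \<alpha> d0" "{lab z, lab (\<alpha> z)} = {labH h, labH (\<alpha>H h)}"
    using adm assms(1) unfolding admissible_H_def by blast
  have *: thesis if y: "y \<in> D" "lab y = labH h" "lab (\<alpha> y) = labH (\<alpha>H h)" "medge \<alpha> y \<noteq> medge \<alpha> d0" for y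
  proof (rule result[OF _ _ y(4)])
    show "y \<in> {x, \<sigma> x, \<sigma> (\<sigma> x)}" using lab_eq_iff[OF assms(2) y(1)] y(2) assms(3) by simp
    show "h \<in> over y" using y assms(1) unfolding over_def by simp
  qed
  \<comment> \<open>Admissibility matches edges as unordered pairs, so h runs along z or along its
    reverse.\<close>
  have "medge \<alpha> (\<alpha> z) = medge \<alpha> z" using z(1) unfolding medge_def by auto
  then show thesis using z *[of z] *[of "\<alpha> z"] by (auto simp: doubleton_eq_iff)
qed

lemma over_disjoint:
  assumes "x \<in> D" "y \<in> D" "x \<noteq> y"
  shows "over x \<inter> over y = {}"
  using no_parallel[OF w3 assms(1,2)] assms(3) unfolding over_def by auto

lemma mult_sum:
  assumes "x \<in> D"
  shows "mult x + mult (\<sigma> x) + mult (\<sigma> (\<sigma> x)) = 3"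
proof -
  obtain h where h: "h \<in> DH" "labH h = lab x" using labs assms by (metis imageE imageI)
  have "{y \<in> DH. labH y = labH h} = over x \<union> over (\<sigma> x) \<union> over (\<sigma> (\<sigma> x))"
  proof
    show "{y \<in> DH. labH y = labH h} \<subseteq> over x \<union> over (\<sigma> x) \<union> over (\<sigma> (\<sigma> x))"
    proof
      fix y assume "y \<in> {y \<in> DH. labH y = labH h}"
      then have "y \<in> DH" "labH y = lab x" using h by auto
      then show "y \<in> over x \<union> over (\<sigma> x) \<union> over (\<sigma> (\<sigma> x))"
        using over_exists[OF _ assms, of y] by auto
    qed
    show "over x \<union> over (\<sigma> x) \<union> over (\<sigma> (\<sigma> x)) \<subseteq> {y \<in> DH. labH y = labH h}"
      unfolding over_def using h assms by auto
  qed
  moreover have "over x \<inter> over (\<sigma> x) = {}" "(over x \<union> over (\<sigma> x)) \<inter> over (\<sigma> (\<sigma> x)) = {}"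
    using over_disjoint[of x "\<sigma> x"] over_disjoint[of x "\<sigma> (\<sigma> x)"] over_disjoint[of "\<sigma> x" "\<sigma> (\<sigma> x)"] assms by auto
  ultimately show ?thesis
    using H.card_vertex_darts[OF h(1)] finite_over unfolding mult_def by (simp add: card_Un_disjoint)
qed

text \<open>A dart of H along \<open>d0\<close> would also run along a dart of G on another edge,
  parallel to e.\<close>

lemma mult_d0: "mult d0 = 0"
proof -
  have "over d0 = {}"
  proof (rule ccontr)
    assume "over d0 \<noteq> {}"
    then obtain h where h: "h \<in> over d0" by blast
    then have "h \<in> DH" "labH h = lab d0" unfolding over_def by auto
    then obtain y where y: "y \<in> {d0, \<sigma> d0, \<sigma> (\<sigma> d0)}" "h \<in> over y" "medge \<alpha> y \<noteq> medge \<alpha> d0"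
      using over_exists[OF _ d0] by blast
    then have "y \<in> D" "y \<noteq> d0" using d0 by auto
    then show False using over_disjoint[OF _ d0, of y] h y(2) by blast
  qed
  then show ?thesis unfolding mult_def by simp
qed

text \<open>A triple edge would be a connected component of its own.\<close>
lemma mult_neq_3:
  assumes x: "x \<in> D"
  shows "mult x \<noteq> 3"
proof
  assume m: "mult x = 3"
  have full: "h \<in> over y" if y: "y \<in> D" "mult y = 3" and h: "h \<in> DH" "labH h = lab y" for y h
  proof -
    have "over y \<subseteq> {k \<in> DH. labH k = labH h}" using h unfolding over_def by auto
    moreover have "card (over y) = card {k \<in> DH. labH k = labH h}"
      using H.card_vertex_darts[OF h(1)] y(2) unfolding mult_def by simp
    ultimately have "over y = {k \<in> DH. labH k = labH h}"
      using H.finite_darts by (intro card_subset_eq) auto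
    then show ?thesis using h by blast
  qed
  have mx: "mult (\<alpha> x) = 3" using mult_alpha[OF x] m by simp
  have "over x \<noteq> {}" using m unfolding mult_def by auto
  then obtain h where h: "h \<in> DH" "labH h = lab x" unfolding over_def by auto
  have all: "labH k \<in> {lab x, lab (\<alpha> x)}" if "k \<in> DH" for k
    using h(1) that
  proof (rule H.connected_induct)
    fix z assume z: "z \<in> DH" "labH z \<in> {lab x, lab (\<alpha> x)}"
    show "labH (\<sigma>H z) \<in> {lab x, lab (\<alpha> x)}" using z by simp
    from z(2) consider "labH z = lab x" | "labH z = lab (\<alpha> x)" by blast
    then show "labH (\<alpha>H z) \<in> {lab x, lab (\<alpha> x)}"
    proof cases
      case 1
      then show ?thesis using full[OF x m z(1)] unfolding over_def by simp
    next
      case 2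
      then show ?thesis using full[OF alpha_in[OF x] mx z(1)] x unfolding over_def by simp
    qed
  qed (use h in simp)
  \<comment> \<open>Another neighbour in G of the vertex of x is a vertex of H that the two ends of
    the triple edge cannot reach.\<close>
  have "lab (\<alpha> (\<sigma> x)) \<in> labH ` DH" unfolding labs using x by simp
  then obtain k where "k \<in> DH" "lab (\<alpha> (\<sigma> x)) = labH k" by (rule imageE)
  then have "lab (\<alpha> (\<sigma> x)) \<in> {lab x, lab (\<alpha> x)}" using all[of k] by simp
  then show False using no_parallel_sigma[OF w3 x] lab_alpha_neq[of "\<sigma> x"] x by auto
qed

section \<open>The alternating cycle through the defective edge\<close>

definition alternating :: "'d set" where
  "alternating = {x \<in> D. mult x = 0 \<or> mult x = 2}"

definition step :: "'d \<Rightarrow> 'd" where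
  "step x = (if mult (\<sigma> (\<alpha> x)) + mult x = 2 then \<sigma> (\<alpha> x) else \<sigma> (\<sigma> (\<alpha> x)))"

lemma alternating_in: "x \<in> alternating \<Longrightarrow> x \<in> D"
  unfolding alternating_def by blast

text \<open>The multiplicities at a vertex sum to 3 and none is 3. If one of them is 0 or 2, all
  three are 0, 1, 2 in some order, so the continuation exists and is unique.\<close>

lemma step_facts:
  assumes "x \<in> alternating"
  shows "step x \<in> alternating" "lab (step x) = lab (\<alpha> x)" "mult (step x) + mult x = 2"
proof -
  have x: "x \<in> D" "mult x = 0 \<or> mult x = 2" using assms unfolding alternating_def by auto
  have "mult x + mult (\<sigma> (\<alpha> x)) + mult (\<sigma> (\<sigma> (\<alpha> x))) = 3"
    "mult (\<sigma> (\<alpha> x)) \<noteq> 3" "mult (\<sigma> (\<sigma> (\<alpha> x))) \<noteq> 3"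
    using mult_sum[of "\<alpha> x"] mult_alpha mult_neq_3 x by auto
  then show m: "mult (step x) + mult x = 2" unfolding step_def using x(2) by auto
  show "lab (step x) = lab (\<alpha> x)" unfolding step_def using x by simp
  have "step x \<in> D" unfolding step_def using x by simp
  then show "step x \<in> alternating" unfolding alternating_def using m x(2) by auto
qed

lemma alternating_unique:
  assumes "x \<in> alternating" "y \<in> alternating" "lab x = lab y" "mult x = mult y"
  shows "x = y"
  using mult_sum[of x] mult_neq_3 lab_eq_iff[of x y] assms unfolding alternating_def by force

lemma bij_step: "bij_betw step alternating alternating"
proof -
  have fin: "finite alternating" unfolding alternating_def using finite_darts by simp
  have "inj_on step alternating"
  proof (rule inj_onI)
    fix x y assume xy: "x \<in> alternating" "y \<in> alternating" "step x = step y"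
    then have "lab (\<alpha> x) = lab (\<alpha> y)" "mult x = mult y" using step_facts[OF xy(1)] step_facts[OF xy(2)] by auto
    moreover have "\<alpha> x \<in> alternating" "\<alpha> y \<in> alternating"
      using xy mult_alpha unfolding alternating_def by auto
    ultimately have "\<alpha> x = \<alpha> y"
      using alternating_unique mult_alpha alternating_in xy by metis
    then show "x = y" using alpha_eq_iff alternating_in xy by metis
  qed
  moreover have "step ` alternating \<subseteq> alternating" using step_facts(1) by blast
  ultimately show ?thesis using endo_inj_surj[OF fin] unfolding bij_betw_def by blast
qed

definition walk :: "nat \<Rightarrow> 'd" where "walk j = (step ^^ j) d0"
definition len :: nat where "len = card (orbit step d0)"

lemma d0_alternating: "d0 \<in> alternating"
  unfolding alternating_def using d0 mult_d0 by simp

lemma walk_alternating: "walk j \<in> alternating"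
  unfolding walk_def using d0_alternating step_facts(1) by (induction j) auto

lemma walk_in: "walk j \<in> D"
  using walk_alternating alternating_in by blast

lemma walk_Suc: "walk (Suc j) = step (walk j)"
  unfolding walk_def by simp

lemma mult_walk: "mult (walk j) = (if even j then 0 else 2)"
proof (induction j)
  case 0 then show ?case using mult_d0 by (simp add: walk_def)
next
  case (Suc j)
  then show ?case using step_facts(3)[OF walk_alternating, of j] unfolding walk_Suc by (auto split: if_splits)
qed

lemma lab_walk_Suc: "lab (walk (Suc j)) = lab (\<alpha> (walk j))"
  unfolding walk_Suc using step_facts(2)[OF walk_alternating] .

lemma positive_walk: "positive (walk j) \<longleftrightarrow> (positive d0 \<longleftrightarrow> even j)"
proof (induction j)
  case (Suc j)
  have "positive (walk (Suc j)) = positive (\<alpha> (walk j))"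
    using positive_lab[OF _ _ lab_walk_Suc] walk_in by simp
  then show ?case using positive_alpha[OF walk_in] Suc by simp
qed (simp add: walk_def)

lemma len_facts: "len > 0" "walk len = d0" "inj_on walk {..<len}" "even len"
proof -
  have fin: "finite alternating" unfolding alternating_def using finite_darts by simp
  note p = orbit_period[OF fin bij_step d0_alternating]
  show "len > 0" "walk len = d0" "inj_on walk {..<len}" using p unfolding len_def walk_def by auto
  \<comment> \<open>The walk returns to \<open>d0\<close>, whose multiplicity 0 occurs only at even
    positions.\<close>
  then show "even len" using mult_walk[of len] mult_d0 by (simp split: if_splits)
qed

text \<open>A vertex determines its side of the bipartition, hence the parity of the position, hence
  the multiplicity of the leaving dart, and with it the dart. So the closed walk meets each vertex
  once.\<close>

lemma walk_parity_eq:
  assumes "lab (walk i) = lab (walk j)" shows "walk i = walk j"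
proof -
  have "even i = even j" using positive_lab[OF walk_in walk_in assms] positive_walk by blast
  then show ?thesis using alternating_unique[OF walk_alternating walk_alternating assms] mult_walk by simp
qed

definition cyc :: "'d list" where "cyc = map walk [0..<len]"

text \<open>Traversing an edge in both directions would place both traversals at positions of equal
  parity, as the multiplicity is the same, although the two darts start on opposite sides of the
  bipartition.\<close>

lemma medge_walk_eq:
  assumes "medge \<alpha> (walk i) = medge \<alpha> (walk j)" shows "walk i = walk j"
proof (rule ccontr)
  assume "walk i \<noteq> walk j"
  then have a: "walk i = \<alpha> (walk j)" using assms medge_eq_iff[OF walk_in walk_in] by blast
  then have "mult (walk i) = mult (walk j)" using mult_alpha[OF walk_in] by simp
  then have "even i = even j" using mult_walk by (simp split: if_splits)
  then show False using a positive_alpha[OF walk_in, of j] positive_walk[of i] positive_walk[of j] by metis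
qed

lemma is_cycle_cyc: "is_cycle D \<alpha> lab cyc"
  unfolding is_cycle_def
proof (intro conjI allI impI)
  obtain q where "len = 2 * q" using len_facts(4) by (rule evenE)
  then show "2 \<le> length cyc" using len_facts(1) unfolding cyc_def by simp
  show "set cyc \<subseteq> D" unfolding cyc_def using walk_in by auto
  fix i assume i: "i < length cyc"
  show "lab (\<alpha> (cyc ! i)) = lab (cyc ! ((i + 1) mod length cyc))"
  proof (cases "Suc i = len")
    case True
    then show ?thesis using i lab_walk_Suc[of i] len_facts(1,2) unfolding cyc_def by (simp add: walk_def)
  next
    case False
    then have "Suc i < len" using i unfolding cyc_def by simp
    then show ?thesis using lab_walk_Suc[of i] unfolding cyc_def by simp
  qed
next
  have "inj_on (\<lambda>j. lab (walk j)) {0..<len}" "inj_on (\<lambda>j. medge \<alpha> (walk j)) {0..<len}"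
    using len_facts(3) walk_parity_eq medge_walk_eq unfolding inj_on_def by (auto simp: atLeast0LessThan)
  then show "distinct (map lab cyc)" "distinct (map (medge \<alpha>) cyc)"
    unfolding cyc_def by (simp_all add: distinct_map comp_def)
qed

lemma Rcount_ge: "len div 2 - 1 \<le> Rcount (map_adj D \<alpha> lab) (map_adj DH \<alpha>H labH) (lab d0) (lab (\<alpha> d0))"
proof -
  let ?pair = "\<lambda>x. {lab x, lab (\<alpha> x)}"
  let ?Z = "{p. \<exists>x y. p = {x, y} \<and> map_adj D \<alpha> lab x y \<and> \<not> map_adj DH \<alpha>H labH x y}"
  let ?J = "(\<lambda>i. 2 * i) ` {..<len div 2}"
  have "?Z \<subseteq> ?pair ` D" unfolding map_adj_def by auto
  then have fin: "finite ?Z" using finite_darts finite_subset by blast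
  have "(\<lambda>j. ?pair (walk j)) ` ?J \<subseteq> ?Z"
  proof
    fix p assume "p \<in> (\<lambda>j. ?pair (walk j)) ` ?J"
    then obtain i where p: "p = ?pair (walk (2 * i))" by blast
    have "over (walk (2 * i)) = {}" using mult_walk[of "2 * i"] finite_over unfolding mult_def by simp
    have "\<not> map_adj DH \<alpha>H labH (lab (walk (2 * i))) (lab (\<alpha> (walk (2 * i))))"
    proof
      assume "map_adj DH \<alpha>H labH (lab (walk (2 * i))) (lab (\<alpha> (walk (2 * i))))"
      then obtain h where h: "h \<in> DH" "{labH h, labH (\<alpha>H h)} = ?pair (walk (2 * i))"
        unfolding map_adj_def by blast
      then have "h \<in> over (walk (2 * i)) \<or> \<alpha>H h \<in> over (walk (2 * i))"
        unfolding over_def by (auto simp: doubleton_eq_iff)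
      then show False using \<open>over (walk (2 * i)) = {}\<close> by blast
    qed
    moreover have "map_adj D \<alpha> lab (lab (walk (2 * i))) (lab (\<alpha> (walk (2 * i))))"
      unfolding map_adj_def using walk_in by blast
    ultimately show "p \<in> ?Z" using p by blast
  qed
  moreover have "inj_on (\<lambda>j. ?pair (walk j)) ?J"
  proof (rule inj_onI)
    fix i j assume ij: "i \<in> ?J" "j \<in> ?J" "?pair (walk i) = ?pair (walk j)"
    have "walk i = walk j" by (rule medge_walk_eq[OF no_parallel_medge[OF w3 walk_in walk_in ij(3)]])
    moreover have "i < len" "j < len" using ij by auto
    ultimately show "i = j" using len_facts(3) unfolding inj_on_def by blast
  qed
  ultimately have "card ?J \<le> card ?Z" by (intro card_inj_on_le[OF _ _ fin])
  moreover have "card ?J = len div 2" by (subst card_image) (auto simp: inj_on_def)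
  moreover have "card ?Z - 1 \<le> card (?Z - {{lab d0, lab (\<alpha> d0)}})"
    using fin by (simp add: card_Diff_singleton_if)
  ultimately show ?thesis unfolding Rcount_def by linarith
qed

text \<open>For each type the lighter of the two faces at an edge has weight at most 8, so a shorter
  alternating cycle falls below the bound for non-contractible cycles.\<close>

lemma len_ge_weight:
  assumes T: "of_type T D \<alpha> \<sigma>" and large: "noncontr_cycles_longer 8 D \<alpha> \<sigma> lab"
  shows "len \<ge> min (weight \<alpha> \<sigma> d0) (weight \<alpha> \<sigma> (\<alpha> d0))"
proof (rule ccontr)
  assume "\<not> ?thesis"
  then have short: "len < weight \<alpha> \<sigma> d0" "len < weight \<alpha> \<sigma> (\<alpha> d0)" by auto
  have "sort [weight \<alpha> \<sigma> d0, weight \<alpha> \<sigma> (\<sigma> d0), weight \<alpha> \<sigma> (\<sigma> (\<sigma> d0))] = config_of T"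
    using T d0 unfolding of_type_def vertex_config_def by simp
  then have "len < 8" using short d0 by (cases T) (auto split: if_splits)
  have l: "length cyc = len" unfolding cyc_def by simp
  have c0: "cyc ! 0 = d0" unfolding cyc_def using len_facts(1) by (simp add: walk_def)
  have con: "contractible D \<alpha> \<sigma> (medge \<alpha> ` set cyc)"
    using large is_cycle_cyc \<open>len < 8\<close> l unfolding noncontr_cycles_longer_def by fastforce
  have "len \<noteq> 2"
  proof
    assume "len = 2"
    then have "walk 2 = d0" using len_facts(2) by simp
    then have "lab (\<alpha> (walk 1)) = lab d0" "lab (walk 1) = lab (\<alpha> d0)"
      using lab_walk_Suc[of 1] lab_walk_Suc[of 0] by (auto simp: walk_def numeral_2_eq_2)
    then have "walk 1 = \<alpha> d0" using no_parallel[OF w3 walk_in, of "\<alpha> d0" 1] d0 by simp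
    then show False using mult_walk[of 1] mult_alpha[OF d0] mult_d0 by simp
  qed
  moreover obtain q where "len = 2 * q" using len_facts(4) by (rule evenE)
  ultimately have "len = 4 \<or> len = 6" using len_facts(1) \<open>len < 8\<close> by auto
  then show False using no_short_contractible_cycle[OF T is_cycle_cyc con] short l c0 by simp
qed

end

theorem theorem4:
  fixes D :: "'d set" and \<alpha> \<sigma> :: "'d \<Rightarrow> 'd" and lab :: "'d \<Rightarrow> 'v"
    and fc :: "'d set set \<Rightarrow> col" and T :: lattype and d0 :: 'd and S :: "'d set set"
  assumes G: "torus_lattice D \<alpha> \<sigma> lab"
    and colouring: "proper_colouring D \<alpha> \<sigma> fc"
    and ltype: "of_type T D \<alpha> \<sigma>"
    and large: "noncontr_cycles_longer 8 D \<alpha> \<sigma> lab"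
    and d0: "d0 \<in> D"
    and S: "S \<in> {mface \<alpha> \<sigma> d0, mface \<alpha> \<sigma> (\<alpha> d0)}"
    and Smin: "\<forall>S' \<in> {mface \<alpha> \<sigma> d0, mface \<alpha> \<sigma> (\<alpha> d0)}. card S \<le> card S'"
  shows "let e = medge \<alpha> d0; v1 = lab d0; v2 = lab (\<alpha> d0); K = card S;
             G' = defective_edge (map_edges D \<alpha>) (\<lambda>\<epsilon>. lab ` \<epsilon>) (map_faces D \<alpha> \<sigma>) fc e S;
             RG' = Rcount (map_adj D \<alpha> lab) (ms_adj (fst G') (fst (snd G'))) v1 v2
         in RG' = (K - 2) div 2 \<and>
            RG' = expected_R T (\<exists>S' \<in> {mface \<alpha> \<sigma> d0, mface \<alpha> \<sigma> (\<alpha> d0)}. card S' = 4) \<and>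
            (\<forall>(DH :: 'h set) \<alpha>H \<sigma>H labH. admissible_H D \<alpha> lab d0 DH \<alpha>H \<sigma>H labH \<longrightarrow>
               RG' \<le> Rcount (map_adj D \<alpha> lab) (map_adj DH \<alpha>H labH) v1 v2)"
proof -
  interpret coloured_map D \<alpha> \<sigma> lab fc
    using G colouring unfolding torus_lattice_def by unfold_locales auto
  define G' where "G' = defective_edge (map_edges D \<alpha>) (\<lambda>\<epsilon>. lab ` \<epsilon>) (map_faces D \<alpha> \<sigma>) fc (medge \<alpha> d0) S"
  define R where "R = Rcount (map_adj D \<alpha> lab) (ms_adj (fst G') (fst (snd G'))) (lab d0) (lab (\<alpha> d0))"
  have config: "sort [weight \<alpha> \<sigma> x, weight \<alpha> \<sigma> (\<sigma> x), weight \<alpha> \<sigma> (\<sigma> (\<sigma> x))] = config_of T" if "x \<in> D" for x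
    using ltype that unfolding of_type_def vertex_config_def by simp
  have w3: "weight \<alpha> \<sigma> x \<ge> 3" if "x \<in> D" for x
    using config[OF that] by (cases T) (auto split: if_splits)
  \<comment> \<open>Orient the defective edge so that its dart lies on the shrink face.\<close>
  obtain s where s: "s \<in> {d0, \<alpha> d0}" "S = mface \<alpha> \<sigma> s" using S by blast
  have sD: "s \<in> D" using s(1) d0 by auto
  have e: "medge \<alpha> s = medge \<alpha> d0" "{lab s, lab (\<alpha> s)} = {lab d0, lab (\<alpha> d0)}"
    using s(1) d0 by (auto simp: medge_def)
  have K: "card S = weight \<alpha> \<sigma> s" unfolding s(2) weight_def ..
  have "Rcount (map_adj D \<alpha> lab) (ms_adj (fst G') (fst (snd G'))) (lab s) (lab (\<alpha> s)) = (card S - 2) div 2"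
    unfolding K by (rule Rcount_output[OF sD _ w3]) (simp add: G'_def e(1) s(2))
  \<comment> \<open>\<open>Rcount\<close> depends only on the unordered pair of ends, so the
    reorientation does not affect it.\<close>
  then have R: "R = (card S - 2) div 2" unfolding R_def Rcount_def e(2) .
  have Kmin: "card S \<le> weight \<alpha> \<sigma> d0" "card S \<le> weight \<alpha> \<sigma> (\<alpha> d0)"
    using Smin unfolding weight_def by auto
  have Kin: "card S = weight \<alpha> \<sigma> d0 \<or> card S = weight \<alpha> \<sigma> (\<alpha> d0)" using K s(1) by auto
  have "(\<exists>S' \<in> {mface \<alpha> \<sigma> d0, mface \<alpha> \<sigma> (\<alpha> d0)}. card S' = 4) \<longleftrightarrow>
      weight \<alpha> \<sigma> d0 = 4 \<or> weight \<alpha> \<sigma> (\<alpha> d0) = 4" unfolding weight_def by auto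
  then have E: "R = expected_R T (\<exists>S' \<in> {mface \<alpha> \<sigma> d0, mface \<alpha> \<sigma> (\<alpha> d0)}. card S' = 4)"
    using config[OF d0] Kmin Kin d0 unfolding R by (cases T) (auto split: if_splits)
  have H: "R \<le> Rcount (map_adj D \<alpha> lab) (map_adj DH \<alpha>H labH) (lab d0) (lab (\<alpha> d0))"
    if adm: "admissible_H D \<alpha> lab d0 DH \<alpha>H \<sigma>H labH" for DH :: "'h set" and \<alpha>H \<sigma>H labH
  proof -
    obtain fcH where "coloured_map DH \<alpha>H \<sigma>H labH fcH"
      using adm unfolding admissible_H_def torus_lattice_def coloured_map_def by blast
    then interpret H: coloured_map DH \<alpha>H \<sigma>H labH fcH .
    interpret competitor D \<alpha> \<sigma> lab fc DH \<alpha>H \<sigma>H labH fcH d0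
      using w3 d0 adm by unfold_locales auto
    have "card S \<le> len" using len_ge_weight[OF ltype large] Kmin by linarith
    then have "(card S - 2) div 2 \<le> len div 2 - 1" by linarith
    then show ?thesis using Rcount_ge unfolding R by linarith
  qed
  show ?thesis
    unfolding Let_def G'_def[symmetric] R_def[symmetric] using R E H by blast
qed

end
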